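(* Let $\Gamma=(G,\sigma)$ be a signed graph on $N$ vertices and $k\in\{1,2,\dots,N\}$. Then at least one of the following holds: (i) $h^{\sigma}_1(\mu_1)\leq 8k\,\lambda_1(L^{\sigma})$; (ii) $h_1^{\sigma}(\mu_1)< 16\sqrt{2d_{\max}}\,k\,\dfrac{\lambda_1(L^{\sigma})}{\sqrt{\lambda_k(L^{\sigma})}}$, where $d_{\max}=\max_{u\in V}d_u$.
   Context: A signed graph $\Gamma=(G,\sigma)$ consists of a finite simple undirected graph $G=(V,E)$ with $N=|V|$ vertices, positive symmetric edge weights $w_{uv}>0$ for $\{u,v\}\in E$ ($w_{uv}=0$ otherwise), and a signature $\sigma:E\to\{+1,-1\}$; write $\sigma(uv)=\sigma(\{u,v\})$. The degree is $d_u=\sum_v w_{uv}$, $D=\mathrm{diag}(d_u)$, $A^{\sigma}_{uv}=\sigma(uv)w_{uv}$ for edges and $0$ otherwise, and $L^\sigma=D-A^\sigma$ with eigenvalues $\lambda_1(L^\sigma)\le\cdots\le\lambda_N(L^\sigma)$. $\mu_1\equiv1$ on $V$; for a positive measure $\mu$, $\mathrm{vol}_\mu(S)=\sum_{u\in S}\mu(u)$. For $V_1,V_2\subseteq V$, $|E(V_1,V_2)|=\sum_{u\in V_1}\sum_{v\in V_2}w_{uv}$, $|E^{\pm}(V_1,V_2)|=\sum_{u\in V_1}\sum_{v\in V_2,\sigma(uv)=\pm1}w_{uv}$, $|E^\pm(V_1)|=|E^\pm(V_1,V_1)|$. For disjoint $V_1,V_2$ with $V_1\cup V_2\ne\emptyset$,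 $$\beta^{\sigma}(V_1,V_2)=\frac{2|E^{+}(V_1,V_2)|+|E^-(V_1)|+|E^-(V_2)|+|E(V_1\cup V_2,\overline{V_1\cup V_2})|}{\mathrm{vol}_{\mu}(V_1\cup V_2)},$$ and $h_1^\sigma(\mu)$ is its minimum over all such pairs. *)

theory Defs
  imports "HOL-Analysis.Analysis"
begin

text \<open>
  The vertex set of a graph is a whole finite type. Edges are two-element sets, and the
  signature is a function on edges; its values outside the edge set are never used.
\<close>

record 'v sgraph =
  edges :: "'v set set"
  weight :: "'v \<Rightarrow> 'v \<Rightarrow> real"
  signature :: "'v set \<Rightarrow> real"

definition signed_graph :: "('v::finite) sgraph \<Rightarrow> bool" where
  "signed_graph \<Gamma> \<longleftrightarrow>
     (\<forall>e \<in> edges \<Gamma>. card e = 2) \<and>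
     (\<forall>u v. weight \<Gamma> u v = weight \<Gamma> v u) \<and>
     (\<forall>u v. {u, v} \<in> edges \<Gamma> \<longrightarrow> weight \<Gamma> u v > 0) \<and>
     (\<forall>u v. {u, v} \<notin> edges \<Gamma> \<longrightarrow> weight \<Gamma> u v = 0) \<and>
     (\<forall>e \<in> edges \<Gamma>. signature \<Gamma> e \<in> {1, -1})"

definition wdegree :: "('v::finite) sgraph \<Rightarrow> 'v \<Rightarrow> real" where
  "wdegree \<Gamma> u = (\<Sum>v\<in>UNIV. weight \<Gamma> u v)"

definition max_degree :: "('v::finite) sgraph \<Rightarrow> real" where
  "max_degree \<Gamma> = Max (range (wdegree \<Gamma>))"

definition degree_matrix :: "('v::finite) sgraph \<Rightarrow> real^'v^'v" where
  "degree_matrix \<Gamma> = (\<chi> u v. if u = v then wdegree \<Gamma> u else 0)"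

definition signed_adjacency :: "('v::finite) sgraph \<Rightarrow> real^'v^'v" where
  "signed_adjacency \<Gamma> =
     (\<chi> u v. if {u, v} \<in> edges \<Gamma> then signature \<Gamma> {u, v} * weight \<Gamma> u v else 0)"

definition signed_laplacian :: "('v::finite) sgraph \<Rightarrow> real^'v^'v" where
  "signed_laplacian \<Gamma> = degree_matrix \<Gamma> - signed_adjacency \<Gamma>"

definition charpoly :: "real^'n^'n \<Rightarrow> real poly" where
  "charpoly M = det (\<chi> i j. (if i = j then [:0, 1:] else 0) - [:M $ i $ j:])"

text \<open>
  The \<open>k\<close>-th smallest eigenvalue, counted from 1 and with multiplicity. It is meant for
  symmetric matrices (all roots of the characteristic polynomial are real) and
  for \<open>k\<close> between 1 and the dimension.
\<close>

definition eigval :: "nat \<Rightarrow> real^'n^'n \<Rightarrow> real" where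
  "eigval k M = sorted_list_of_multiset (proots (charpoly M)) ! (k - 1)"

definition vol :: "('v \<Rightarrow> real) \<Rightarrow> 'v set \<Rightarrow> real" where
  "vol \<mu> S = (\<Sum>u\<in>S. \<mu> u)"

text \<open>
  All three edge quantities sum over ordered pairs, so that an edge inside
  \<open>V\<^sub>1 \<inter> V\<^sub>2\<close> contributes twice.
\<close>

definition edge_weight :: "('v::finite) sgraph \<Rightarrow> 'v set \<Rightarrow> 'v set \<Rightarrow> real" where
  "edge_weight \<Gamma> V1 V2 = (\<Sum>u\<in>V1. \<Sum>v\<in>V2. weight \<Gamma> u v)"

definition pos_edge_weight :: "('v::finite) sgraph \<Rightarrow> 'v set \<Rightarrow> 'v set \<Rightarrow> real" where
  "pos_edge_weight \<Gamma> V1 V2 =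
     (\<Sum>u\<in>V1. \<Sum>v \<in> {v \<in> V2. {u, v} \<in> edges \<Gamma> \<and> signature \<Gamma> {u, v} = 1}. weight \<Gamma> u v)"

definition neg_edge_weight :: "('v::finite) sgraph \<Rightarrow> 'v set \<Rightarrow> 'v set \<Rightarrow> real" where
  "neg_edge_weight \<Gamma> V1 V2 =
     (\<Sum>u\<in>V1. \<Sum>v \<in> {v \<in> V2. {u, v} \<in> edges \<Gamma> \<and> signature \<Gamma> {u, v} = -1}. weight \<Gamma> u v)"

definition signed_bipartiteness_ratio ::
    "('v::finite) sgraph \<Rightarrow> ('v \<Rightarrow> real) \<Rightarrow> 'v set \<Rightarrow> 'v set \<Rightarrow> real" where
  "signed_bipartiteness_ratio \<Gamma> \<mu> V1 V2 =
     (2 * pos_edge_weight \<Gamma> V1 V2 + neg_edge_weight \<Gamma> V1 V1 + neg_edge_weight \<Gamma> V2 V2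
        + edge_weight \<Gamma> (V1 \<union> V2) (- (V1 \<union> V2)))
     / vol \<mu> (V1 \<union> V2)"

definition signed_cheeger :: "('v::finite) sgraph \<Rightarrow> ('v \<Rightarrow> real) \<Rightarrow> real" where
  "signed_cheeger \<Gamma> \<mu> =
     Min {signed_bipartiteness_ratio \<Gamma> \<mu> V1 V2 | V1 V2. V1 \<inter> V2 = {} \<and> V1 \<union> V2 \<noteq> {}}"

end

theory Submission
  imports Defs
begin

text \<open>
  Let \<open>f\<close> be a unit eigenvector for \<open>\<lambda>\<^sub>1\<close>. Thresholds \<open>0 = t\<^sub>0 \<le> \<dots> \<le> t\<^bsub>2k\<^esub>\<close> on \<open>\<bar>f\<bar>\<close> are chosen
  greedily so that the functions \<open>u \<mapsto> dist (f u, {\<plusminus>t\<^sub>i})\<close>, restricted to the layer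
  \<open>t\<^sub>i \<le> \<bar>f\<bar> \<le> t\<^bsub>i+1\<^esub>\<close> and given the sign of \<open>f\<close>, all have squared norm
  \<open>C = 2\<lambda>\<^sub>1/(k\<lambda>\<^sub>k)\<close> until \<open>max \<bar>f\<bar>\<close> is reached. If it is not reached after \<open>2k\<close> steps, these
  are \<open>2k\<close> disjointly supported functions whose energies add up to at most \<open>\<lambda>\<^sub>1\<close>; the span of the
  \<open>k\<close> best ones shows \<open>\<lambda>\<^sub>k < 2\<lambda>\<^sub>1/(kC)\<close>, a contradiction. Otherwise \<open>f\<close> is close to a step function,
  and applying the co-area inequality to the antiderivative of the distance to the thresholds,
  evaluated at \<open>f\<close>, gives
  \<open>h \<le> 4k\<lambda>\<^sub>1 + 8k \<surd>(2d\<^bsub>max\<^esub>) \<lambda>\<^sub>1/\<surd>\<lambda>\<^sub>k\<close>.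
\<close>

section \<open>Eigenvalues of symmetric matrices\<close>

text \<open>The first-order condition at a maximum: for small \<open>t\<close> a nonzero linear term
  beats a quadratic one. The test value \<open>t = b / L\<close> with \<open>L\<close> above
  \<open>\<bar>K\<bar>\<close> makes this explicit.\<close>

lemma linear_term_dominated_zero:
  fixes b K :: real
  assumes "\<And>t. 2 * t * b \<le> K * t\<^sup>2"
  shows "b = 0"
proof (rule ccontr)
  assume "b \<noteq> 0"
  define L where "L = \<bar>K\<bar> + 1"
  have L: "L > 0" "K < L" by (auto simp: L_def)
  have "2 * (b / L) * b \<le> K * (b / L)\<^sup>2" by (rule assms)
  hence "2 * b\<^sup>2 * L \<le> K * b\<^sup>2"
    using L by (simp add: power2_eq_square field_simps)
  also have "K * b\<^sup>2 < 2 * b\<^sup>2 * L"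
    using L \<open>b \<noteq> 0\<close> mult_strict_right_mono[of K "2 * L" "b\<^sup>2"] by (simp add: mult_ac)
  finally show False by simp
qed

text \<open>The Rayleigh quotient attains its maximum on the compact unit sphere of
  \<open>S\<close>. The residual \<open>w = T v - c v\<close> at a maximizer \<open>v\<close> stays
  in \<open>S\<close> by invariance, and varying \<open>v\<close> in the direction \<open>w\<close>
  forces \<open>w\<close> to vanish.\<close>

lemma selfadjoint_eigenvector_in_subspace:
  fixes T :: "'a::euclidean_space \<Rightarrow> 'a"
  assumes T: "linear T" and sa: "\<And>x y. T x \<bullet> y = x \<bullet> T y"
    and S: "subspace S" and inv: "T ` S \<subseteq> S" and ne: "S \<noteq> {0}"
  obtains v c where "v \<in> S" "norm v = 1" "T v = c *\<^sub>R v"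
proof -
  obtain u where u: "u \<in> S" "u \<noteq> 0" using ne S subspace_0 by blast
  have "u /\<^sub>R norm u \<in> sphere 0 1 \<inter> S" using u S by (auto simp: subspace_scale)
  hence ne': "sphere 0 1 \<inter> S \<noteq> {}" by blast
  have "compact (sphere 0 1 \<inter> S)" using S by (intro compact_Int_closed closed_subspace) auto
  moreover have "continuous_on (sphere 0 1 \<inter> S) (\<lambda>x. x \<bullet> T x)"
    using T by (intro continuous_intros linear_continuous_on) (simp add: linear_conv_bounded_linear)
  ultimately obtain v where v: "v \<in> sphere 0 1 \<inter> S"
    and max: "\<And>y. y \<in> sphere 0 1 \<inter> S \<Longrightarrow> y \<bullet> T y \<le> v \<bullet> T v"
    using continuous_attains_sup[OF _ ne'] by metis
  define c where "c = v \<bullet> T v"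
  have le: "y \<bullet> T y \<le> c * (y \<bullet> y)" if "y \<in> S" for y
  proof (cases "y = 0")
    case False
    have "(y /\<^sub>R norm y) \<bullet> T (y /\<^sub>R norm y) \<le> c"
      unfolding c_def using that S False by (intro max) (auto simp: subspace_scale)
    hence "(y \<bullet> T y) / (norm y)\<^sup>2 \<le> c"
      using linear_scale[OF T] by (simp add: power2_eq_square divide_inverse mult_ac)
    thus ?thesis using False by (simp add: field_simps dot_square_norm)
  qed (simp add: linear_0[OF T])
  define w where "w = T v - c *\<^sub>R v"
  have vS: "v \<in> S" and vv: "v \<bullet> v = 1" using v by (auto simp: dot_square_norm)
  have wS: "w \<in> S" unfolding w_def using vS inv S by (intro subspace_diff subspace_scale) auto
  \<comment> \<open>The Rayleigh bound at \<open>v + t w\<close>, expanded in \<open>t\<close>: the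
    constant terms cancel because \<open>v\<close> attains the maximum, and the contributions of
    \<open>w \<bullet> v\<close> agree on both sides.\<close>
  have "2 * t * (w \<bullet> w) \<le> (c * (w \<bullet> w) - w \<bullet> T w) * t\<^sup>2" for t
  proof -
    have "(v + t *\<^sub>R w) \<bullet> T (v + t *\<^sub>R w) \<le> c * ((v + t *\<^sub>R w) \<bullet> (v + t *\<^sub>R w))"
      using vS wS S by (intro le subspace_add subspace_scale)
    moreover have "w \<bullet> T v = w \<bullet> w + c * (w \<bullet> v)" by (simp add: w_def algebra_simps inner_simps)
    moreover have "v \<bullet> T w = w \<bullet> T v" using sa[of v w] by (simp add: inner_commute)
    moreover have "v \<bullet> w = w \<bullet> v" by (rule inner_commute)
    moreover have "T (v + t *\<^sub>R w) = T v + t *\<^sub>R T w" by (simp add: linear_add[OF T] linear_scale[OF T])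
    ultimately show ?thesis using vv c_def
      by (simp add: inner_simps algebra_simps power2_eq_square)
  qed
  hence "w \<bullet> w = 0" by (rule linear_term_dominated_zero)
  hence "T v = c *\<^sub>R v" by (simp add: w_def)
  with vS v show ?thesis using that by auto
qed

text \<open>Induction on the dimension: after splitting off a unit eigenvector, its orthogonal
  complement in \<open>S\<close> is again invariant because \<open>T\<close> is
  self-adjoint.\<close>

lemma selfadjoint_orthonormal_eigenbasis:
  fixes T :: "'a::euclidean_space \<Rightarrow> 'a"
  assumes T: "linear T" and sa: "\<And>x y. T x \<bullet> y = x \<bullet> T y"
    and S: "subspace S" and inv: "T ` S \<subseteq> S"
  shows "\<exists>B. B \<subseteq> S \<and> pairwise orthogonal B \<and> (\<forall>v\<in>B. norm v = 1) \<and>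
             (\<forall>v\<in>B. \<exists>c. T v = c *\<^sub>R v) \<and> S \<subseteq> span B"
  using S inv
proof (induction "dim S" arbitrary: S rule: less_induct)
  case less
  show ?case
  proof (cases "S = {0}")
    case True
    thus ?thesis by (intro exI[of _ "{}"]) (auto simp: pairwise_def)
  next
    case False
    obtain v c where v: "v \<in> S" "norm v = 1" "T v = c *\<^sub>R v"
      using selfadjoint_eigenvector_in_subspace[OF T sa less.prems False] by metis
    define S' where "S' = {y \<in> S. v \<bullet> y = 0}"
    have vv: "v \<bullet> v = 1" using v by (simp add: dot_square_norm)
    have sub: "subspace S'" using less.prems(1) unfolding S'_def subspace_def
      by (auto simp: inner_simps)
    have inv': "T ` S' \<subseteq> S'"
    proof
      fix z assume "z \<in> T ` S'"
      then obtain y where y: "y \<in> S" "v \<bullet> y = 0" "z = T y" by (auto simp: S'_def)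
      have "v \<bullet> T y = 0" using sa[of v y] y v(3) by simp
      thus "z \<in> S'" using y less.prems(2) by (auto simp: S'_def)
    qed
    have "S' \<subset> S" using v(1) vv unfolding S'_def by (smt (verit) mem_Collect_eq psubsetI subsetI)
    hence "span S' \<subset> span S" using sub less.prems(1) by (metis span_eq_iff)
    hence "dim S' < dim S" by (rule dim_psubset)
    from less.hyps[OF this sub inv'] obtain B where
      B: "B \<subseteq> S'" "pairwise orthogonal B" "\<forall>v\<in>B. norm v = 1" "\<forall>v\<in>B. \<exists>c. T v = c *\<^sub>R v" "S' \<subseteq> span B"
      by blast
    show ?thesis
    proof (intro exI[of _ "insert v B"] conjI)
      show "insert v B \<subseteq> S" using B(1) v by (auto simp: S'_def)
      show "pairwise orthogonal (insert v B)"
        using B(1,2) by (auto simp: pairwise_insert S'_def orthogonal_def inner_commute)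
      show "\<forall>v\<in>insert v B. norm v = 1" "\<forall>v\<in>insert v B. \<exists>c. T v = c *\<^sub>R v" using B v by auto
      show "S \<subseteq> span (insert v B)"
      proof
        fix x assume x: "x \<in> S"
        have "x - (v \<bullet> x) *\<^sub>R v \<in> S'"
          using x v less.prems(1) vv by (auto simp: S'_def inner_simps intro!: subspace_diff subspace_scale)
        hence "x - (v \<bullet> x) *\<^sub>R v \<in> span B" using B(5) by blast
        thus "x \<in> span (insert v B)" by (auto simp: span_insert)
      qed
    qed
  qed
qed

lemma symmetric_matrix_eigenbasis:
  fixes M :: "real^'n^'n"
  assumes "transpose M = M"
  obtains b :: "'n \<Rightarrow> real^'n" and d where
    "\<And>i j. b i \<bullet> b j = (if i = j then 1 else 0)" "\<And>i. M *v b i = d i *\<^sub>R b i"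
    "\<And>x. (\<Sum>i\<in>UNIV. (b i \<bullet> x) *\<^sub>R b i) = x"
proof -
  have sa: "(M *v x) \<bullet> y = x \<bullet> (M *v y)" for x y
    by (metis assms dot_lmul_matrix vector_transpose_matrix)
  obtain B where B: "pairwise orthogonal B" "\<forall>v\<in>B. norm v = 1"
     "\<forall>v\<in>B. \<exists>c. M *v v = c *\<^sub>R v" "UNIV \<subseteq> span B"
    using selfadjoint_orthonormal_eigenbasis[OF matrix_vector_mul_linear[of M] sa subspace_UNIV]
    by auto
  have ind: "independent B" using B by (intro pairwise_orthogonal_independent) auto
  have "card B = dim (UNIV :: (real^'n) set)"
    using B ind by (intro basis_card_eq_dim) auto
  hence "card B = CARD('n)" by simp
  then obtain b where b: "bij_betw b (UNIV :: 'n set) B"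
    using finite_same_card_bij[of "UNIV :: 'n set" B] independent_imp_finite[OF ind] by auto
  from B(3) obtain e where e: "\<forall>v\<in>B. M *v v = e v *\<^sub>R v" by metis
  show ?thesis
  proof (rule that[of b "e \<circ> b"])
    fix i j
    have bi: "b i \<in> B" "b j \<in> B" using b by (auto simp: bij_betw_def)
    show "b i \<bullet> b j = (if i = j then 1 else 0)"
    proof (cases "i = j")
      case True
      thus ?thesis using B(2) bi by (simp add: dot_square_norm)
    next
      case False
      hence "b i \<noteq> b j" using b by (auto simp: bij_betw_def inj_on_def)
      thus ?thesis using False B(1) bi by (auto simp: pairwise_def orthogonal_def)
    qed
    show "M *v b i = (e \<circ> b) i *\<^sub>R b i" using e bi by simp
  next
    fix x :: "real^'n"
    have "(\<Sum>v\<in>B. (x \<bullet> v) *\<^sub>R v) = x"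
      using B independent_imp_finite[OF ind] by (intro orthonormal_basis_expand) auto
    thus "(\<Sum>i\<in>UNIV. (b i \<bullet> x) *\<^sub>R b i) = x"
      using sum.reindex_bij_betw[OF b, of "\<lambda>v. (x \<bullet> v) *\<^sub>R v"] by (simp add: inner_commute)
  qed
qed

section \<open>The characteristic polynomial and the sorted eigenvalues\<close>

text \<open>Carries real matrix identities over to the polynomial ring, where the determinant
  defining \<open>charpoly\<close> is taken.\<close>

lemma map_matrix_const_poly_mult:
  fixes A :: "real^'n^'m" and B :: "real^'k^'n"
  shows "map_matrix (\<lambda>x. [:x:]) (A ** B) = map_matrix (\<lambda>x. [:x:]) A ** map_matrix (\<lambda>x. [:x:]) B"
proof -
  have sum: "[:sum f (UNIV :: 'n set):] = (\<Sum>i\<in>UNIV. [:f i:])" for f :: "'n \<Rightarrow> real"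
    using monom_sum[of f UNIV 0] by (simp add: monom_0)
  show ?thesis
    by (simp add: vec_eq_iff map_matrix_def matrix_matrix_mult_def sum mult.commute)
qed


text \<open>The eigenvectors as columns of \<open>P\<close> give \<open>M ** P = P ** E\<close> with
  \<open>E\<close> diagonal. This is transported to polynomial matrices and compared on
  determinants, where the nonzero factor \<open>det (cm P)\<close> cancels in an integral
  domain.\<close>

lemma charpoly_symmetric_eigenbasis:
  fixes M :: "real^'n^'n" and b :: "'n \<Rightarrow> real^'n"
  assumes on: "\<And>i j. b i \<bullet> b j = (if i = j then 1 else 0)"
    and eig: "\<And>i. M *v b i = d i *\<^sub>R b i"
  shows "charpoly M = (\<Prod>i\<in>UNIV. [:- d i, 1:])"
proof -
  define P :: "real^'n^'n" where "P = (\<chi> i j. b j $ i)"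
  define E :: "real^'n^'n" where "E = (\<chi> i j. if i = j then d i else 0)"
  define cm :: "real^'n^'n \<Rightarrow> real poly^'n^'n" where "cm = map_matrix (\<lambda>x. [:x:])"
  define X :: "real poly^'n^'n" where "X = (\<chi> i j. if i = j then [:0, 1:] else 0)"
  have cm_mult: "cm (A ** B) = cm A ** cm B" for A B
    unfolding cm_def by (rule map_matrix_const_poly_mult)
  have char: "charpoly A = det (X - cm A)" for A
    unfolding charpoly_def by (rule arg_cong[of _ _ det]) (simp add: vec_eq_iff X_def cm_def)
  have "transpose P ** P = mat 1"
    using on by (simp add: vec_eq_iff matrix_matrix_mult_def transpose_def P_def mat_def inner_vec_def)
  hence "cm (transpose P) ** cm P = cm (mat 1)" by (metis cm_mult)
  also have "cm (mat 1) = mat 1" by (simp add: vec_eq_iff cm_def mat_def)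
  finally have "det (cm (transpose P)) * det (cm P) = 1" by (metis det_I det_mul)
  hence nz: "det (cm P) \<noteq> 0" by auto
  have "M ** P = P ** E"
  proof (subst vec_eq_iff, intro allI, subst vec_eq_iff, intro allI)
    fix i j
    have "(M ** P) $ i $ j = (M *v b j) $ i"
      by (simp add: matrix_matrix_mult_def matrix_vector_mult_def P_def)
    also have "\<dots> = d j * b j $ i" by (simp add: eig)
    also have "\<dots> = (P ** E) $ i $ j"
      by (simp add: matrix_matrix_mult_def P_def E_def mult_ac if_distrib[of "\<lambda>x. _ * x"] cong: if_cong)
    finally show "(M ** P) $ i $ j = (P ** E) $ i $ j" .
  qed
  hence "cm M ** cm P = cm P ** cm E" by (metis cm_mult)
  moreover have "X ** cm P = cm P ** X"
    by (simp add: vec_eq_iff matrix_matrix_mult_def X_def mult_ac if_distrib[of "\<lambda>x. _ * x"] cong: if_cong)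
  moreover have "(A - B) ** C = A ** C - B ** C" "C ** (A - B) = C ** A - C ** B"
    for A B C :: "real poly^'n^'n"
    by (simp_all add: vec_eq_iff matrix_matrix_mult_def algebra_simps sum_subtractf)
  ultimately have "(X - cm M) ** cm P = cm P ** (X - cm E)" by metis
  hence "det (X - cm M) * det (cm P) = det (cm P) * det (X - cm E)" by (metis det_mul)
  hence "det (X - cm M) = det (X - cm E)" using nz by simp
  also have "\<dots> = (\<Prod>i\<in>UNIV. (X - cm E) $ i $ i)"
    by (rule det_diagonal) (simp add: X_def E_def cm_def)
  also have "\<dots> = (\<Prod>i\<in>UNIV. [:- d i, 1:])" by (simp add: X_def E_def cm_def)
  finally show ?thesis by (simp add: char)
qed

lemma eigval_eigenbasis:
  fixes M :: "real^'n^'n" and b :: "'n \<Rightarrow> real^'n"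
  assumes on: "\<And>i j. b i \<bullet> b j = (if i = j then 1 else 0)"
    and eig: "\<And>i. M *v b i = d i *\<^sub>R b i"
  shows "eigval k M = sorted_list_of_multiset (image_mset d (mset_set UNIV)) ! (k - 1)"
proof -
  have "proots (charpoly M) = (\<Sum>i\<in>UNIV. proots [:- d i, 1:])"
    unfolding charpoly_symmetric_eigenbasis[OF on eig] by (rule proots_prod) simp
  also have "\<dots> = (\<Sum>i\<in>UNIV. {#d i#})" by simp
  also have "\<dots> = image_mset d (mset_set UNIV)"
    by (rule sum_unfold_sum_mset[of "\<lambda>i. {#d i#}" UNIV, THEN trans]) (induction "mset_set (UNIV :: 'n set)", auto)
  finally show ?thesis by (simp add: eigval_def)
qed

text \<open>In a sorted list, entries strictly below the one at position \<open>j\<close> can only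
  stand before position \<open>j\<close>. Ties merely lower the count, so the bound survives
  repeated eigenvalues.\<close>

lemma nth_sorted_list_of_image_mset:
  fixes d :: "'n::finite \<Rightarrow> 'a::linorder"
  assumes "j < CARD('n)"
  defines "xs \<equiv> sorted_list_of_multiset (image_mset d (mset_set UNIV))"
  shows "xs ! j \<in> range d" and "card {i. d i < xs ! j} \<le> j"
proof -
  have ms: "mset xs = image_mset d (mset_set UNIV)" by (simp add: xs_def)
  have len: "length xs = CARD('n)" by (metis ms size_mset size_image_mset size_mset_set)
  have "set xs = range d" by (metis ms set_mset_mset finite_set_mset_mset_set set_image_mset finite)
  with assms(1) len show "xs ! j \<in> range d" by (metis nth_mem)
  have sorted: "sorted xs" unfolding xs_def by simp
  have "card {i. d i < xs ! j} = size (filter_mset (\<lambda>x. x < xs ! j) (image_mset d (mset_set UNIV)))"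
    by (simp add: filter_mset_image_mset)
  also have "\<dots> = length (filter (\<lambda>x. x < xs ! j) xs)" by (metis ms mset_filter size_mset)
  also have "\<dots> = card {i. i < length xs \<and> xs ! i < xs ! j}" by (rule length_filter_conv_card)
  also have "\<dots> \<le> card {..<j}"
    using sorted by (intro card_mono) (auto simp: not_le[symmetric] dest: sorted_nth_mono)
  finally show "card {i. d i < xs ! j} \<le> j" by simp
qed

lemma eigval_is_eigenvalue:
  fixes M :: "real^'n^'n"
  assumes "transpose M = M" "k \<in> {1..CARD('n)}"
  obtains v where "norm v = 1" "M *v v = eigval k M *\<^sub>R v"
proof -
  obtain b :: "'n \<Rightarrow> real^'n" and d where
    b: "\<And>i j. b i \<bullet> b j = (if i = j then 1 else 0)" "\<And>i. M *v b i = d i *\<^sub>R b i"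
    by (rule symmetric_matrix_eigenbasis[OF assms(1)], rule that)
  have "eigval k M \<in> range d"
    unfolding eigval_eigenbasis[OF b] using assms(2) by (intro nth_sorted_list_of_image_mset(1)) auto
  then obtain i where "eigval k M = d i" by auto
  with b that[of "b i"] show ?thesis by (simp add: norm_eq_1)
qed

lemma eigval_mono:
  fixes M :: "real^'n^'n"
  assumes "transpose M = M" "1 \<le> j" "j \<le> k" "k \<le> CARD('n)"
  shows "eigval j M \<le> eigval k M"
proof -
  obtain b :: "'n \<Rightarrow> real^'n" and d where
    b: "\<And>i j. b i \<bullet> b j = (if i = j then 1 else 0)" "\<And>i. M *v b i = d i *\<^sub>R b i"
    by (rule symmetric_matrix_eigenbasis[OF assms(1)], rule that)
  have "length (sorted_list_of_multiset (image_mset d (mset_set UNIV))) = CARD('n)"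
    by (metis mset_sorted_list_of_multiset size_mset size_image_mset size_mset_set)
  thus ?thesis unfolding eigval_eigenbasis[OF b] using assms
    by (intro sorted_nth_mono) auto
qed

text \<open>One half of the Courant-Fischer principle. Fewer than \<open>k\<close> basis vectors
  have an eigenvalue below \<open>eigval k M\<close>, so their orthogonal complement meets
  \<open>W\<close> nontrivially; there the quadratic form is at least
  \<open>eigval k M * (x \<bullet> x)\<close>.\<close>

lemma eigval_le_on_subspace:
  fixes M :: "real^'n^'n"
  assumes sym: "transpose M = M" and k: "k \<in> {1..CARD('n)}"
    and W: "subspace W" "dim W \<ge> k"
    and le: "\<And>x. x \<in> W \<Longrightarrow> x \<bullet> (M *v x) \<le> c * (x \<bullet> x)"
  shows "eigval k M \<le> c"
proof (rule ccontr)
  assume "\<not> eigval k M \<le> c"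
  hence lt: "c < eigval k M" by simp
  obtain b :: "'n \<Rightarrow> real^'n" and d where
    b: "\<And>i j. b i \<bullet> b j = (if i = j then 1 else 0)" "\<And>i. M *v b i = d i *\<^sub>R b i"
    and expand: "\<And>x. (\<Sum>i\<in>UNIV. (b i \<bullet> x) *\<^sub>R b i) = x"
    by (rule symmetric_matrix_eigenbasis[OF sym], rule that)
  \<comment> \<open>The strict inequality leaves fewer than \<open>k\<close> indices even when
    \<open>eigval k M\<close> is a multiple eigenvalue.\<close>
  define I where "I = {i. d i < eigval k M}"
  have cI: "card I < k" unfolding I_def eigval_eigenbasis[OF b]
    using nth_sorted_list_of_image_mset(2)[of "k - 1" d] k by fastforce
  define T where "T = {y. \<forall>x\<in>span (b ` I). orthogonal x y}"
  have "dim (span (b ` I)) \<le> card (b ` I)" by (simp add: dim_le_card')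
  also have "\<dots> \<le> card I" by (rule card_image_le) simp
  finally have "dim (span (b ` I)) < k" using cI by simp
  moreover have "dim T + dim (span (b ` I)) = CARD('n)"
    using dim_subspace_orthogonal_to_vectors[of "span (b ` I)" UNIV] by (simp add: T_def)
  moreover have sT: "subspace T" unfolding T_def by (rule subspace_orthogonal_to_vectors)
  moreover have "dim {x + y |x y. x \<in> W \<and> y \<in> T} \<le> CARD('n)"
    using dim_subset_UNIV_cart[of "{x + y |x y. x \<in> W \<and> y \<in> T}"] by simp
  ultimately have "dim (W \<inter> T) > 0"
    using dim_sums_Int[OF W(1) sT] W(2) by linarith
  hence "\<not> W \<inter> T \<subseteq> {0}" using dim_eq_0 by (metis less_irrefl)
  then obtain x where x: "x \<in> W" "x \<in> T" "x \<noteq> 0" by blast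
  have ox: "b i \<bullet> x = 0" if "i \<in> I" for i
    using x(2) that span_base[of "b i" "b ` I"] by (auto simp: T_def orthogonal_def)
  have "x \<bullet> x = x \<bullet> (\<Sum>i\<in>UNIV. (b i \<bullet> x) *\<^sub>R b i)" by (simp only: expand)
  hence quad: "x \<bullet> x = (\<Sum>i\<in>UNIV. (b i \<bullet> x)\<^sup>2)"
    by (simp add: inner_sum_right inner_commute power2_eq_square)
  have "M *v x = M *v (\<Sum>i\<in>UNIV. (b i \<bullet> x) *\<^sub>R b i)" by (simp only: expand)
  also have "\<dots> = (\<Sum>i\<in>UNIV. (b i \<bullet> x) *\<^sub>R (M *v b i))"
    by (simp add: linear_sum[OF matrix_vector_mul_linear] matrix_vector_mult_scaleR)
  finally have "M *v x = (\<Sum>i\<in>UNIV. (b i \<bullet> x) *\<^sub>R (M *v b i))" .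
  hence "x \<bullet> (M *v x) = (\<Sum>i\<in>UNIV. d i * (b i \<bullet> x)\<^sup>2)"
    by (simp add: b(2) inner_sum_right inner_commute power2_eq_square mult_ac)
  also have "\<dots> \<ge> (\<Sum>i\<in>UNIV. eigval k M * (b i \<bullet> x)\<^sup>2)"
  proof (rule sum_mono)
    fix i show "eigval k M * (b i \<bullet> x)\<^sup>2 \<le> d i * (b i \<bullet> x)\<^sup>2"
      using ox[of i] by (cases "i \<in> I") (auto simp: I_def intro: mult_right_mono)
  qed
  also have "(\<Sum>i\<in>UNIV. eigval k M * (b i \<bullet> x)\<^sup>2) = eigval k M * (x \<bullet> x)"
    by (simp add: quad sum_distrib_left)
  finally have "eigval k M * (x \<bullet> x) \<le> c * (x \<bullet> x)" using le[OF x(1)] by linarith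
  moreover have "x \<bullet> x > 0" using x(3) by simp
  ultimately show False using lt by simp
qed

section \<open>Distance to thresholds on the real line\<close>

text \<open>
  \<open>layer a b x\<close> is the part of \<open>x\<close> lying in \<open>a \<le> \<bar>x\<bar> \<le> b\<close>, with the sign of \<open>x\<close>. In this
  coordinate the estimates for a single layer add up over consecutive layers by telescoping,
  and \<open>tent_integral L\<close> is the antiderivative of \<open>\<bar>tent L\<bar>\<close>.
\<close>

definition layer :: "real \<Rightarrow> real \<Rightarrow> real \<Rightarrow> real" where
  "layer a b x = max a (min x b) + min (- a) (max x (- b))"

text \<open>For \<open>\<bar>y\<bar> \<le> L\<close> the absolute value is the distance from
  \<open>\<bar>y\<bar>\<close> to the set of end points 0 and \<open>L\<close>; the factor
  \<open>sgn y\<close> makes the function odd.\<close>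

definition tent :: "real \<Rightarrow> real \<Rightarrow> real" where
  "tent L y = sgn y * min \<bar>y\<bar> (L - \<bar>y\<bar>)"

definition tent_integral :: "real \<Rightarrow> real \<Rightarrow> real" where
  "tent_integral L y = sgn y * (if \<bar>y\<bar> \<le> L / 2 then y\<^sup>2 / 2 else L\<^sup>2 / 4 - (L - \<bar>y\<bar>)\<^sup>2 / 2)"

lemma layer_minus: "layer a b (- x) = - layer a b x"
  by (auto simp: layer_def max_def min_def)

lemma layer_mono: "x \<le> y \<Longrightarrow> layer a b x \<le> layer a b y"
  by (auto simp: layer_def max_def min_def)

lemma abs_layer_le: "0 \<le> a \<Longrightarrow> a \<le> b \<Longrightarrow> \<bar>layer a b x\<bar> \<le> b - a"
  by (auto simp: layer_def max_def min_def)

lemma abs_layer: "0 \<le> a \<Longrightarrow> a \<le> b \<Longrightarrow> \<bar>layer a b x\<bar> = max 0 (min \<bar>x\<bar> b - a)"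
  by (auto simp: layer_def max_def min_def)

lemma layer_split: "0 \<le> a \<Longrightarrow> a \<le> b \<Longrightarrow> b \<le> c \<Longrightarrow> layer a b x + layer b c x = layer a c x"
  by (auto simp: layer_def max_def min_def)

lemma layer_zero: "0 \<le> b \<Longrightarrow> layer 0 b x = max (- b) (min x b)"
  by (auto simp: layer_def max_def min_def)

lemma sum_layer:
  assumes "mono t" "t 0 = 0"
  shows "(\<Sum>i<n. layer (t i) (t (Suc i)) x) = layer 0 (t n) x"
proof (induction n)
  case (Suc n)
  have "0 \<le> t n" "t n \<le> t (Suc n)" using assms by (metis monoD zero_le, simp add: monoD)
  thus ?case using Suc layer_split[of 0 "t n" "t (Suc n)" x] by simp
qed (simp add: assms layer_zero)

text \<open>Each layer coordinate is monotone, so for ordered arguments the absolute values open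
  with the same sign and the sum telescopes to a difference of clipped values; clipping does not
  increase distances.\<close>

lemma sum_abs_layer_diff_le:
  assumes "mono t" "t 0 = 0"
  shows "(\<Sum>i<n. \<bar>layer (t i) (t (Suc i)) x - layer (t i) (t (Suc i)) y\<bar>) \<le> \<bar>x - y\<bar>"
proof (induction x y rule: linorder_wlog)
  case (le x y)
  have "(\<Sum>i<n. \<bar>layer (t i) (t (Suc i)) x - layer (t i) (t (Suc i)) y\<bar>) =
    (\<Sum>i<n. layer (t i) (t (Suc i)) y - layer (t i) (t (Suc i)) x)"
    using layer_mono[OF le] by (intro sum.cong) auto
  also have "\<dots> = layer 0 (t n) y - layer 0 (t n) x"
    by (simp add: sum_subtractf sum_layer[OF assms])
  also have "\<dots> \<le> y - x"
    using le assms by (subst (1 2) layer_zero) (auto simp: max_def min_def, metis monoD zero_le)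
  finally show ?case using le by simp
qed (simp add: abs_minus_commute)

lemma sgn_layer: "0 \<le> a \<Longrightarrow> a \<le> b \<Longrightarrow> layer a b x = sgn x * \<bar>layer a b x\<bar>"
  by (auto simp: layer_def max_def min_def sgn_if)

section \<open>Tents and their antiderivatives\<close>

lemma tent_minus: "tent L (- y) = - tent L y"
  by (simp add: tent_def sgn_minus)

lemma tent_integral_minus: "tent_integral L (- y) = - tent_integral L y"
  by (simp add: tent_integral_def sgn_minus)

lemma abs_tent: "\<bar>y\<bar> \<le> L \<Longrightarrow> \<bar>tent L y\<bar> = min \<bar>y\<bar> (L - \<bar>y\<bar>)"
  by (auto simp: tent_def sgn_if)

lemma tent_lipschitz:
  assumes "\<bar>x\<bar> \<le> L" "\<bar>y\<bar> \<le> L"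
  shows "\<bar>tent L x - tent L y\<bar> \<le> \<bar>x - y\<bar>"
  using assms by (auto simp: tent_def sgn_if min_def split: if_splits)

text \<open>Quadratic growth up to the midpoint, and beyond it the gap is a quarter of
  \<open>(L - z) * (3 * z - L)\<close>. The constant 1/4 is attained at
  \<open>\<bar>y\<bar> = L\<close>.\<close>

lemma tent_integral_ge:
  assumes "\<bar>y\<bar> \<le> L"
  shows "y\<^sup>2 / 4 \<le> sgn y * tent_integral L y"
proof -
  define z where "z = \<bar>y\<bar>"
  have z: "0 \<le> z" "z \<le> L" and yz: "y\<^sup>2 = z\<^sup>2" using assms by (auto simp: z_def)
  have "z\<^sup>2 / 4 \<le> (if z \<le> L / 2 then z\<^sup>2 / 2 else L\<^sup>2 / 4 - (L - z)\<^sup>2 / 2)"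
  proof (cases "z \<le> L / 2")
    case False
    have "0 \<le> (L - z) * (3 * z - L)" using False z by (intro mult_nonneg_nonneg) auto
    thus ?thesis using False by (simp add: power2_eq_square field_simps)
  qed simp
  thus ?thesis
    by (cases "y = 0") (auto simp: tent_integral_def z_def[symmetric] yz sgn_if split: if_splits)
qed

text \<open>The tent has slopes 1 and -1 here, so its integral from \<open>y\<close> to
  \<open>x\<close> exceeds the trapezoid value by at most a multiple of
  \<open>(x - y)\<^sup>2\<close>. The cases follow the position of the peak
  \<open>L / 2\<close>.\<close>

lemma tent_integral_nonneg_diff:
  assumes "0 \<le> y" "y \<le> x" "x \<le> L"
  shows "0 \<le> tent_integral L x - tent_integral L y"
    "tent_integral L x - tent_integral L y \<le> (x - y) * (tent L x + tent L y + (x - y)) / 2"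
proof -
  have eq: "tent_integral L z = (if z \<le> L / 2 then z\<^sup>2 / 2 else L\<^sup>2 / 4 - (L - z)\<^sup>2 / 2)"
    "tent L z = min z (L - z)" if "0 \<le> z" "z \<le> L" for z
    using that by (auto simp: tent_integral_def tent_def sgn_if)
  have x: "0 \<le> x" "x \<le> L" and y: "0 \<le> y" "y \<le> L" using assms by auto
  consider "x \<le> L / 2" | "y \<le> L / 2" "L / 2 < x" | "L / 2 < y" using assms by linarith
  hence "0 \<le> tent_integral L x - tent_integral L y \<and>
    tent_integral L x - tent_integral L y \<le> (x - y) * (tent L x + tent L y + (x - y)) / 2"
  proof cases
    case 1
    have "y\<^sup>2 \<le> x\<^sup>2" "0 \<le> (x - y)\<^sup>2" using assms by (auto intro: power_mono)
    thus ?thesis using 1 assms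
      by (simp add: eq[OF x] eq[OF y] power2_eq_square algebra_simps)
  next
    case 2
    \<comment> \<open>With the peak in between, \<open>tent L x + tent L y + (x - y)\<close>
      collapses to \<open>L\<close>, and this sum of squares is twice the gap in the upper
      bound.\<close>
    have "0 \<le> (L / 2 - (L - x))\<^sup>2 + (L / 2 - y)\<^sup>2" by simp
    hence "L\<^sup>2 / 4 - (L - x)\<^sup>2 / 2 - y\<^sup>2 / 2 \<le> (x - y) * L / 2"
      by (simp add: power2_eq_square field_simps)
    moreover have "y\<^sup>2 \<le> (L / 2)\<^sup>2" "(L - x)\<^sup>2 \<le> (L / 2)\<^sup>2"
      using 2 x y by (auto intro!: power_mono)
    hence "0 \<le> L\<^sup>2 / 4 - (L - x)\<^sup>2 / 2 - y\<^sup>2 / 2" by (simp add: power_divide)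
    ultimately show ?thesis using 2 assms by (simp add: eq[OF x] eq[OF y])
  next
    case 3
    have "(L - x)\<^sup>2 \<le> (L - y)\<^sup>2" using assms by (intro power_mono) auto
    moreover have "0 \<le> (x - y) * (x - y)" by simp
    ultimately show ?thesis using 3 assms
      by (simp add: eq[OF x] eq[OF y] min_def power2_eq_square field_simps)
  qed
  thus "0 \<le> tent_integral L x - tent_integral L y"
    "tent_integral L x - tent_integral L y \<le> (x - y) * (tent L x + tent L y + (x - y)) / 2" by auto
qed

text \<open>By oddness two sign patterns remain. For equal signs the previous estimate applies; for
  opposite signs it is applied from 0 to each point and the two results are added.\<close>

lemma tent_integral_diff_le:
  assumes "\<bar>x\<bar> \<le> L" "\<bar>y\<bar> \<le> L"
  shows "\<bar>tent_integral L x - tent_integral L y\<bar> \<le>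
    \<bar>x - y\<bar> * (\<bar>tent L x\<bar> + \<bar>tent L y\<bar> + \<bar>x - y\<bar>) / 2"
proof -
  have 0: "tent_integral L 0 = 0" "tent L 0 = 0" by (simp_all add: tent_integral_def tent_def)
  have pos: "tent L z \<ge> 0" if "0 \<le> z" "z \<le> L" for z
    using that by (auto simp: tent_def sgn_if)
  have same: "\<bar>tent_integral L x - tent_integral L y\<bar> \<le>
    \<bar>x - y\<bar> * (\<bar>tent L x\<bar> + \<bar>tent L y\<bar> + \<bar>x - y\<bar>) / 2"
    if "0 \<le> x" "0 \<le> y" "x \<le> L" "y \<le> L" for x y
    using that
  proof (induction x y rule: linorder_wlog)
    case (le x y)
    thus ?case using tent_integral_nonneg_diff[of x y L] pos[of x] pos[of y]
      by (simp add: add_ac)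
  qed (simp add: abs_minus_commute add_ac)
  have opp: "\<bar>tent_integral L x - tent_integral L (- y)\<bar> \<le>
    \<bar>x - - y\<bar> * (\<bar>tent L x\<bar> + \<bar>tent L (- y)\<bar> + \<bar>x - - y\<bar>) / 2"
    if "0 \<le> x" "0 \<le> y" "x \<le> L" "y \<le> L" for x y
  proof -
    have x: "0 \<le> tent_integral L x" "tent_integral L x \<le> x * (tent L x + x) / 2"
      using tent_integral_nonneg_diff[of 0 x L] that by (simp_all add: 0)
    have y: "0 \<le> tent_integral L y" "tent_integral L y \<le> y * (tent L y + y) / 2"
      using tent_integral_nonneg_diff[of 0 y L] that by (simp_all add: 0)
    define p q where "p = tent L x" and "q = tent L y"
    \<comment> \<open>These cross terms are the difference between the wanted product and the sum of
      the two one-sided bounds.\<close>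
    have "0 \<le> x * (q + y)" "0 \<le> y * (p + x)"
      using that pos[of x] pos[of y] by (simp_all add: p_def q_def)
    moreover have "(x + y) * (p + q + (x + y)) = x * (p + x) + y * (q + y) + x * (q + y) + y * (p + x)"
      by (simp add: algebra_simps)
    moreover have "a + b \<le> (c + d + e + e') / 2" if "a \<le> c / 2" "b \<le> d / 2" "0 \<le> e" "0 \<le> e'"
      for a b c d e e' :: real using that by simp
    ultimately have "tent_integral L x + tent_integral L y \<le> (x + y) * (p + q + (x + y)) / 2"
      using x(2) y(2) unfolding p_def q_def by metis
    hence "tent_integral L x + tent_integral L y \<le> (x + y) * (tent L x + tent L y + (x + y)) / 2"
      by (simp add: p_def q_def)
    thus ?thesis using that x y pos[of x] pos[of y] by (simp add: tent_integral_minus tent_minus)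
  qed
  consider "0 \<le> x" "0 \<le> y" | "0 \<le> x" "0 \<le> - y" | "0 \<le> - x" "0 \<le> y" | "0 \<le> - x" "0 \<le> - y"
    by linarith
  thus ?thesis
  proof cases
    case 1
    thus ?thesis using same[of x y] assms by simp
  next
    case 2
    thus ?thesis using opp[of x "- y"] assms by simp
  next
    case 3
    thus ?thesis using opp[of y "- x"] assms by (simp add: abs_minus_commute add_ac)
  next
    case 4
    thus ?thesis using same[of "- x" "- y"] assms
      by (simp add: tent_integral_minus tent_minus abs_minus_commute)
  qed
qed

section \<open>Bumps on the layers and the profile function\<close>

text \<open>The signed distance to the thresholds \<open>a\<close> and \<open>b\<close>, extended by
  zero outside the layer. Being odd, it commutes with multiplication by an edge sign.\<close>

definition bump :: "real \<Rightarrow> real \<Rightarrow> real \<Rightarrow> real" where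
  "bump a b x = tent (b - a) (layer a b x)"

lemma bump_minus: "bump a b (- x) = - bump a b x"
  by (simp add: bump_def layer_minus tent_minus)

lemma abs_bump: "0 \<le> a \<Longrightarrow> a \<le> b \<Longrightarrow> \<bar>bump a b x\<bar> = max 0 (min (\<bar>x\<bar> - a) (b - \<bar>x\<bar>))"
  by (simp add: bump_def abs_tent[OF abs_layer_le] abs_layer max_def min_def)

lemma bump_diff_le:
  assumes "0 \<le> a" "a \<le> b"
  shows "\<bar>bump a b x - bump a b y\<bar> \<le> \<bar>layer a b x - layer a b y\<bar>"
  unfolding bump_def using assms by (intro tent_lipschitz abs_layer_le)

text \<open>A bump is nonzero only if \<open>\<bar>x\<bar>\<close> lies strictly between its two
  thresholds, and these open intervals are disjoint.\<close>

lemma bump_unique_index: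
  assumes "mono t" "t 0 = 0" "bump (t i) (t (Suc i)) x \<noteq> 0" "bump (t j) (t (Suc j)) x \<noteq> 0"
  shows "i = j"
proof -
  have *: "t m < \<bar>x\<bar>" "\<bar>x\<bar> < t (Suc m)" if "bump (t m) (t (Suc m)) x \<noteq> 0" for m
  proof -
    have "0 \<le> t m" "t m \<le> t (Suc m)" using assms(1,2) by (metis monoD zero_le, simp add: monoD)
    from abs_bump[OF this, of x] that show "t m < \<bar>x\<bar>" "\<bar>x\<bar> < t (Suc m)"
      by (auto simp: max_def min_def split: if_splits)
  qed
  from *[OF assms(3)] *[OF assms(4)] have "t i < t (Suc j)" "t j < t (Suc i)" by auto
  hence "i < Suc j" "j < Suc i" using assms(1) by (meson monoD not_less)+
  thus ?thesis by simp
qed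

text \<open>A sum of squares is at most the square of the sum of absolute values, which the layer
  estimate controls. The constant 1 lets the energies of all bumps add up to at most the energy of
  \<open>f\<close>.\<close>

lemma sum_bump_diff_square_le:
  assumes "mono t" "t 0 = 0"
  shows "(\<Sum>i<n. (bump (t i) (t (Suc i)) x - bump (t i) (t (Suc i)) y)\<^sup>2) \<le> (x - y)\<^sup>2"
proof -
  let ?d = "\<lambda>i. \<bar>bump (t i) (t (Suc i)) x - bump (t i) (t (Suc i)) y\<bar>"
  have "0 \<le> t i" "t i \<le> t (Suc i)" for i using assms by (metis monoD zero_le, simp add: monoD)
  hence "(\<Sum>i<n. ?d i) \<le> (\<Sum>i<n. \<bar>layer (t i) (t (Suc i)) x - layer (t i) (t (Suc i)) y\<bar>)"
    by (intro sum_mono bump_diff_le)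
  also have "\<dots> \<le> \<bar>x - y\<bar>" by (rule sum_abs_layer_diff_le[OF assms])
  finally have le: "(\<Sum>i<n. ?d i) \<le> \<bar>x - y\<bar>" .
  have "(\<Sum>i<n. (?d i)\<^sup>2) \<le> (\<Sum>i<n. \<bar>x - y\<bar> * ?d i)"
  proof (rule sum_mono)
    fix i assume "i \<in> {..<n}"
    hence "?d i \<le> (\<Sum>i<n. ?d i)" by (intro member_le_sum) auto
    with le have "?d i \<le> \<bar>x - y\<bar>" by linarith
    thus "(?d i)\<^sup>2 \<le> \<bar>x - y\<bar> * ?d i" 
      unfolding power2_eq_square by (intro mult_right_mono) auto
  qed
  also have "\<dots> \<le> \<bar>x - y\<bar> * \<bar>x - y\<bar>"
    unfolding sum_distrib_left[symmetric] using le by (intro mult_left_mono) auto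
  finally show ?thesis by (simp add: power2_eq_square)
qed

text \<open>The antiderivative of the distance to the thresholds.\<close>

definition profile :: "(nat \<Rightarrow> real) \<Rightarrow> nat \<Rightarrow> real \<Rightarrow> real" where
  "profile t n x = (\<Sum>i<n. tent_integral (t (Suc i) - t i) (layer (t i) (t (Suc i)) x))"

lemma profile_minus: "profile t n (- x) = - profile t n x"
  by (simp add: profile_def layer_minus tent_integral_minus sum_negf)

text \<open>Layer by layer, the tent estimate has a bracket bounded by the common quantity
  \<open>?K\<close>; the remaining factors \<open>?d i\<close> add up to at most
  \<open>\<bar>x - y\<bar>\<close>.\<close>

lemma profile_diff_le:
  assumes "mono t" "t 0 = 0"
  shows "\<bar>profile t n x - profile t n y\<bar> \<le> \<bar>x - y\<bar> *
    ((\<Sum>i<n. \<bar>bump (t i) (t (Suc i)) x\<bar>) + (\<Sum>i<n. \<bar>bump (t i) (t (Suc i)) y\<bar>) + \<bar>x - y\<bar>) / 2"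
    (is "_ \<le> \<bar>x - y\<bar> * ?K / 2")
proof -
  let ?l = "\<lambda>i. layer (t i) (t (Suc i))"
  let ?d = "\<lambda>i. \<bar>?l i x - ?l i y\<bar>"
  have le: "(\<Sum>i<n. ?d i) \<le> \<bar>x - y\<bar>" by (rule sum_abs_layer_diff_le[OF assms])
  have t: "0 \<le> t i" "t i \<le> t (Suc i)" for i using assms by (metis monoD zero_le, simp add: monoD)
  have "\<bar>profile t n x - profile t n y\<bar> \<le> (\<Sum>i<n. \<bar>tent_integral (t (Suc i) - t i) (?l i x) -
      tent_integral (t (Suc i) - t i) (?l i y)\<bar>)"
    unfolding profile_def sum_subtractf[symmetric] by (rule sum_abs)
  also have "\<dots> \<le> (\<Sum>i<n. ?d i * ?K / 2)"
  proof (rule sum_mono)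
    fix i assume i: "i \<in> {..<n}"
    have "?d i \<le> (\<Sum>i<n. ?d i)" using i by (intro member_le_sum) auto
    hence "?d i \<le> \<bar>x - y\<bar>" using le by linarith
    moreover have "\<bar>bump (t i) (t (Suc i)) z\<bar> \<le> (\<Sum>i<n. \<bar>bump (t i) (t (Suc i)) z\<bar>)" for z
      using i by (intro member_le_sum[of i _ "\<lambda>i. \<bar>bump (t i) (t (Suc i)) z\<bar>"]) auto
    ultimately have "?d i * (\<bar>bump (t i) (t (Suc i)) x\<bar> + \<bar>bump (t i) (t (Suc i)) y\<bar> + ?d i) \<le> ?d i * ?K"
      by (intro mult_left_mono add_mono) auto
    moreover have "\<bar>tent_integral (t (Suc i) - t i) (?l i x) - tent_integral (t (Suc i) - t i) (?l i y)\<bar>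
       \<le> ?d i * (\<bar>bump (t i) (t (Suc i)) x\<bar> + \<bar>bump (t i) (t (Suc i)) y\<bar> + ?d i) / 2"
      unfolding bump_def by (intro tent_integral_diff_le abs_layer_le t)
    ultimately show "\<bar>tent_integral (t (Suc i) - t i) (?l i x) - tent_integral (t (Suc i) - t i) (?l i y)\<bar>
       \<le> ?d i * ?K / 2" by linarith
  qed
  also have "\<dots> = (\<Sum>i<n. ?d i) * (?K / 2)" by (simp add: sum_distrib_right)
  also have "\<dots> \<le> \<bar>x - y\<bar> * (?K / 2)"
    using le by (intro mult_right_mono) (auto intro!: add_nonneg_nonneg sum_nonneg)
  finally show ?thesis by simp
qed

text \<open>Since \<open>\<bar>x\<bar> \<le> t n\<close>, the layer coordinates add up to
  \<open>x\<close>, and Cauchy-Schwarz over them costs the factor \<open>n\<close>. The tent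
  integrals all carry the sign of \<open>x\<close>, so nothing cancels; the 4 comes from
  \<open>tent_integral_ge\<close>.\<close>

lemma abs_profile_ge:
  assumes "mono t" "t 0 = 0" "\<bar>x\<bar> \<le> t n"
  shows "x\<^sup>2 \<le> 4 * real n * \<bar>profile t n x\<bar>"
proof -
  let ?l = "\<lambda>i. layer (t i) (t (Suc i)) x"
  have t: "0 \<le> t i" "t i \<le> t (Suc i)" for i using assms by (metis monoD zero_le, simp add: monoD)
  have "(\<Sum>i<n. ?l i) = x"
    unfolding sum_layer[OF assms(1,2)] using assms(3) by (subst layer_zero) auto
  hence "x\<^sup>2 = (\<Sum>i<n. ?l i)\<^sup>2" by simp
  also have "\<dots> \<le> real n * (\<Sum>i<n. (?l i)\<^sup>2)"
    using sum_squared_le_sum_of_squares[of ?l "{..<n}"] by (simp add: mult.commute)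
  finally have cs: "x\<^sup>2 \<le> real n * (\<Sum>i<n. (?l i)\<^sup>2)" .
  have "(\<Sum>i<n. (?l i)\<^sup>2) \<le> (\<Sum>i<n. 4 * (sgn x * tent_integral (t (Suc i) - t i) (?l i)))"
  proof (rule sum_mono)
    fix i
    have "(?l i)\<^sup>2 \<le> 4 * (sgn (?l i) * tent_integral (t (Suc i) - t i) (?l i))"
      using tent_integral_ge[OF abs_layer_le[OF t[of i]], of x] by simp
    also have "sgn (?l i) * tent_integral (t (Suc i) - t i) (?l i) = sgn x * tent_integral (t (Suc i) - t i) (?l i)"
    proof (cases "?l i = 0")
      case False
      have "sgn (?l i) = sgn (sgn x * \<bar>?l i\<bar>)" using sgn_layer[OF t[of i], of x] by simp
      thus ?thesis using False by (simp add: sgn_mult)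
    qed (simp add: tent_integral_def)
    finally show "(?l i)\<^sup>2 \<le> 4 * (sgn x * tent_integral (t (Suc i) - t i) (?l i))" .
  qed
  also have "\<dots> = 4 * (sgn x * profile t n x)" by (simp add: profile_def sum_distrib_left)
  also have "\<dots> \<le> 4 * \<bar>profile t n x\<bar>"
    by (cases "x = 0") (auto simp: sgn_if)
  finally have "real n * (\<Sum>i<n. (?l i)\<^sup>2) \<le> real n * (4 * \<bar>profile t n x\<bar>)"
    by (intro mult_left_mono) auto
  with cs show ?thesis by simp
qed

section \<open>Greedy choice of thresholds\<close>

text \<open>Starting from \<open>a\<close>, either the whole rest up to \<open>M\<close> has mass at
  most \<open>C\<close> and the next threshold is \<open>M\<close>, or the intermediate value
  theorem gives a threshold of mass exactly \<open>C\<close>.\<close>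

lemma exists_equal_mass_thresholds:
  fixes f :: "'v::finite \<Rightarrow> real"
  defines "mass \<equiv> \<lambda>a b. \<Sum>u\<in>UNIV. (bump a b (f u))\<^sup>2"
  assumes "0 \<le> C" "0 \<le> M"
  obtains t where "mono t" "t 0 = 0" "\<And>i. mass (t i) (t (Suc i)) \<le> C"
    "t n = M \<or> (\<forall>i<n. mass (t i) (t (Suc i)) = C)"
proof -
  \<comment> \<open>A form of \<open>mass\<close> that is visibly continuous in \<open>b\<close> and
    agrees with it for \<open>0 \<le> a \<le> b\<close>.\<close>
  define m where "m a b = (\<Sum>u\<in>UNIV. (max 0 (min (\<bar>f u\<bar> - a) (b - \<bar>f u\<bar>)))\<^sup>2)" for a b
  have mass: "mass a b = m a b" if "0 \<le> a" "a \<le> b" for a b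
    unfolding mass_def m_def by (simp add: abs_bump[OF that, symmetric])
  have step: "\<exists>b. 0 \<le> b \<and> b \<le> M \<and> a \<le> b \<and> m a b \<le> C \<and> (b = M \<or> m a b = C)"
    if a: "0 \<le> a" "a \<le> M" for a
  proof (cases "m a M \<le> C")
    case True
    thus ?thesis using a by (intro exI[of _ M]) auto
  next
    case False
    have "m a a = 0" unfolding m_def by (intro sum.neutral) (auto simp: max_def min_def)
    moreover have "continuous_on {a..M} (m a)" unfolding m_def by (intro continuous_intros)
    ultimately obtain b where "a \<le> b" "b \<le> M" "m a b = C"
      using IVT'[of "m a" a C M] False a assms by auto
    thus ?thesis using a by (intro exI[of _ b]) auto
  qed
  have "\<exists>t. \<forall>i. (0 \<le> t i \<and> t i \<le> M \<and> (i = 0 \<longrightarrow> t i = 0)) \<and>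
     (t i \<le> t (Suc i) \<and> m (t i) (t (Suc i)) \<le> C \<and> (t (Suc i) = M \<or> m (t i) (t (Suc i)) = C))"
    using step assms by (intro dependent_nat_choice) auto
  then obtain t where t: "\<And>i. 0 \<le> t i" "\<And>i. t i \<le> M" "t 0 = 0" "\<And>i. t i \<le> t (Suc i)"
    "\<And>i. m (t i) (t (Suc i)) \<le> C" "\<And>i. t (Suc i) = M \<or> m (t i) (t (Suc i)) = C" by blast
  have mono: "mono t" using t(4) by (simp add: mono_iff_le_Suc)
  have eq: "mass (t i) (t (Suc i)) = m (t i) (t (Suc i))" for i using t by (intro mass)
  \<comment> \<open>Once \<open>M\<close> is reached, monotonicity and the bound
    \<open>t n \<le> M\<close> keep the sequence there.\<close>
  have "t n = M" if "i < n" "t (Suc i) = M" for i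
    using that monoD[OF mono, of "Suc i" n] t(2)[of n] by simp
  hence "t n = M \<or> (\<forall>i<n. mass (t i) (t (Suc i)) = C)" using t(6) unfolding eq by blast
  with mono t show ?thesis by (intro that[of t]) (auto simp: eq)
qed

section \<open>Energy and variation on a signed graph\<close>

text \<open>The default 1 keeps the value in {1, -1} for every pair, so sums may run over all
  ordered pairs and oddness arguments need no case for non-edges.\<close>

definition edge_sign :: "'v sgraph \<Rightarrow> 'v \<Rightarrow> 'v \<Rightarrow> real" where
  "edge_sign \<Gamma> u v = (if {u, v} \<in> edges \<Gamma> then signature \<Gamma> {u, v} else 1)"

definition energy :: "('v::finite) sgraph \<Rightarrow> ('v \<Rightarrow> real) \<Rightarrow> real" where
  "energy \<Gamma> f = (\<Sum>u\<in>UNIV. \<Sum>v\<in>UNIV. weight \<Gamma> u v * (f u - edge_sign \<Gamma> u v * f v)\<^sup>2) / 2"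

text \<open>The total-variation counterpart of \<open>energy\<close>: on a difference of indicators
  of disjoint sets it is the numerator of the bipartiteness ratio. Halving undoes the ordered-pair
  count.\<close>

definition variation :: "('v::finite) sgraph \<Rightarrow> ('v \<Rightarrow> real) \<Rightarrow> real" where
  "variation \<Gamma> g = (\<Sum>u\<in>UNIV. \<Sum>v\<in>UNIV. weight \<Gamma> u v * \<bar>g u - edge_sign \<Gamma> u v * g v\<bar>) / 2"

lemma weight_commute: "signed_graph \<Gamma> \<Longrightarrow> weight \<Gamma> u v = weight \<Gamma> v u"
  unfolding signed_graph_def by blast

lemma weight_nonneg: "signed_graph \<Gamma> \<Longrightarrow> 0 \<le> weight \<Gamma> u v"
  unfolding signed_graph_def by (metis less_eq_real_def)

lemma weight_nonedge: "signed_graph \<Gamma> \<Longrightarrow> {u, v} \<notin> edges \<Gamma> \<Longrightarrow> weight \<Gamma> u v = 0"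
  unfolding signed_graph_def by blast

lemma signature_cases: "signed_graph \<Gamma> \<Longrightarrow> e \<in> edges \<Gamma> \<Longrightarrow> signature \<Gamma> e = 1 \<or> signature \<Gamma> e = - 1"
  unfolding signed_graph_def by auto

lemma edge_sign_commute: "edge_sign \<Gamma> u v = edge_sign \<Gamma> v u"
  by (simp add: edge_sign_def insert_commute)

lemma edge_sign_cases: "signed_graph \<Gamma> \<Longrightarrow> edge_sign \<Gamma> u v = 1 \<or> edge_sign \<Gamma> u v = - 1"
  unfolding signed_graph_def edge_sign_def by auto

lemma signed_adjacency_eq:
  "signed_graph \<Gamma> \<Longrightarrow> signed_adjacency \<Gamma> $ u $ v = edge_sign \<Gamma> u v * weight \<Gamma> u v"
  unfolding signed_graph_def signed_adjacency_def edge_sign_def by simp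

lemma energy_nonneg: "signed_graph \<Gamma> \<Longrightarrow> 0 \<le> energy \<Gamma> f"
  unfolding energy_def by (simp add: sum_nonneg weight_nonneg)

lemma two_energy:
  "2 * energy \<Gamma> f = (\<Sum>u\<in>UNIV. \<Sum>v\<in>UNIV. weight \<Gamma> u v * (f u - edge_sign \<Gamma> u v * f v)\<^sup>2)"
  by (simp add: energy_def)

lemma variation_nonneg: "signed_graph \<Gamma> \<Longrightarrow> 0 \<le> variation \<Gamma> f"
  unfolding variation_def by (simp add: sum_nonneg weight_nonneg)

lemma wdegree_le_max_degree: "wdegree \<Gamma> u \<le> max_degree \<Gamma>"
  unfolding max_degree_def by (intro Max_ge) auto

lemma wdegree_nonneg: "signed_graph \<Gamma> \<Longrightarrow> 0 \<le> wdegree \<Gamma> u"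
  unfolding wdegree_def by (simp add: sum_nonneg weight_nonneg)

lemma max_degree_nonneg: "signed_graph \<Gamma> \<Longrightarrow> 0 \<le> max_degree \<Gamma>"
  using wdegree_nonneg wdegree_le_max_degree order_trans by blast

lemma transpose_signed_laplacian:
  assumes "signed_graph \<Gamma>"
  shows "transpose (signed_laplacian \<Gamma>) = signed_laplacian \<Gamma>"
  using signed_adjacency_eq[OF assms] edge_sign_commute[of \<Gamma>] weight_commute[OF assms]
  by (simp add: vec_eq_iff transpose_def signed_laplacian_def degree_matrix_def)

lemma sum_weight_square_fst:
  "(\<Sum>u\<in>UNIV. \<Sum>v\<in>UNIV. weight \<Gamma> u v * (f u)\<^sup>2) = (\<Sum>u\<in>UNIV. wdegree \<Gamma> u * (f u)\<^sup>2)"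
  by (simp add: wdegree_def sum_distrib_right)

lemma sum_weight_square_snd:
  assumes "signed_graph \<Gamma>"
  shows "(\<Sum>u\<in>UNIV. \<Sum>v\<in>UNIV. weight \<Gamma> u v * (f v)\<^sup>2) = (\<Sum>u\<in>UNIV. wdegree \<Gamma> u * (f u)\<^sup>2)"
  by (subst sum.swap) (simp add: wdegree_def sum_distrib_right weight_commute[OF assms])

lemma signed_laplacian_quadratic_form:
  assumes \<Gamma>: "signed_graph \<Gamma>"
  shows "x \<bullet> (signed_laplacian \<Gamma> *v x) = energy \<Gamma> (\<lambda>u. x $ u)"
proof -
  let ?w = "weight \<Gamma>" and ?s = "edge_sign \<Gamma>"
  have "x \<bullet> (signed_laplacian \<Gamma> *v x) =
     (\<Sum>u\<in>UNIV. wdegree \<Gamma> u * (x $ u)\<^sup>2) - (\<Sum>u\<in>UNIV. \<Sum>v\<in>UNIV. ?w u v * (?s u v * (x $ u * x $ v)))"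
    unfolding inner_vec_def matrix_vector_mult_def signed_laplacian_def sum_subtractf[symmetric]
  proof (simp, intro sum.cong refl)
    fix u
    have "(\<Sum>v\<in>UNIV. (degree_matrix \<Gamma> $ u $ v - signed_adjacency \<Gamma> $ u $ v) * x $ v) =
      wdegree \<Gamma> u * x $ u - (\<Sum>v\<in>UNIV. ?s u v * ?w u v * x $ v)"
      by (simp add: signed_adjacency_eq[OF \<Gamma>] left_diff_distrib sum_subtractf degree_matrix_def
          if_distrib[of "\<lambda>y. y * _"] cong: if_cong)
    thus "x $ u * (\<Sum>v\<in>UNIV. (degree_matrix \<Gamma> $ u $ v - signed_adjacency \<Gamma> $ u $ v) * x $ v) =
      wdegree \<Gamma> u * (x $ u)\<^sup>2 - (\<Sum>v\<in>UNIV. ?w u v * (?s u v * (x $ u * x $ v)))"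
      by (simp add: right_diff_distrib sum_distrib_left power2_eq_square mult_ac)
  qed
  moreover have "?w u v * (x $ u - ?s u v * x $ v)\<^sup>2 = ?w u v * (x $ u)\<^sup>2 + ?w u v * (x $ v)\<^sup>2
      - 2 * (?w u v * (?s u v * (x $ u * x $ v)))" for u v
    using edge_sign_cases[OF \<Gamma>, of u v] by (auto simp: power2_eq_square algebra_simps)
  hence "2 * energy \<Gamma> (\<lambda>u. x $ u) = 2 * (\<Sum>u\<in>UNIV. wdegree \<Gamma> u * (x $ u)\<^sup>2)
     - 2 * (\<Sum>u\<in>UNIV. \<Sum>v\<in>UNIV. ?w u v * (?s u v * (x $ u * x $ v)))"
    unfolding energy_def
    by (simp add: sum.distrib sum_subtractf sum_weight_square_fst sum_weight_square_snd[OF \<Gamma>]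
        flip: sum_distrib_left)
  ultimately show ?thesis by simp
qed

section \<open>The Cheeger constant and the co-area inequality\<close>

text \<open>Weights vanish off the edges, so \<open>(1 + ?s u v) / 2\<close> and
  \<open>(1 - ?s u v) / 2\<close> select positive and negative edges. The numerator becomes one
  double sum, compared with the variation after symmetrization.\<close>

lemma bipartiteness_ratio_eq_variation:
  assumes \<Gamma>: "signed_graph \<Gamma>" and disj: "V1 \<inter> V2 = {}"
  shows "signed_bipartiteness_ratio \<Gamma> (\<lambda>_. 1) V1 V2 =
    variation \<Gamma> (\<lambda>u. indicator V1 u - indicator V2 u) / real (card (V1 \<union> V2))"
proof -
  let ?w = "weight \<Gamma>" and ?s = "edge_sign \<Gamma>"
  define a b :: "'a \<Rightarrow> real" where "a = indicator V1" and "b = indicator V2"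
  have ind: "(\<Sum>u\<in>S. g u) = (\<Sum>u\<in>UNIV. indicator S u * g u)" for S :: "'a set" and g :: "'a \<Rightarrow> real"
    by (rule sum.mono_neutral_cong_left) auto
  have pos: "pos_edge_weight \<Gamma> S T =
     (\<Sum>u\<in>UNIV. \<Sum>v\<in>UNIV. ?w u v * ((1 + ?s u v) / 2 * (indicator S u * indicator T v)))" for S T
    unfolding pos_edge_weight_def ind[where S = S]
  proof (intro sum.cong refl)
    fix u
    have "(\<Sum>v\<in>{v \<in> T. {u, v} \<in> edges \<Gamma> \<and> signature \<Gamma> {u, v} = 1}. ?w u v) =
      (\<Sum>v\<in>UNIV. ?w u v * ((1 + ?s u v) / 2 * indicator T v))"
      by (intro sum.mono_neutral_cong_left)
        (auto simp: weight_nonedge[OF \<Gamma>] edge_sign_def indicator_def dest: signature_cases[OF \<Gamma>])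
    thus "indicator S u * (\<Sum>v\<in>{v \<in> T. {u, v} \<in> edges \<Gamma> \<and> signature \<Gamma> {u, v} = 1}. ?w u v) =
      (\<Sum>v\<in>UNIV. ?w u v * ((1 + ?s u v) / 2 * (indicator S u * indicator T v)))"
      by (simp add: sum_distrib_left mult_ac)
  qed
  have neg: "neg_edge_weight \<Gamma> S T =
     (\<Sum>u\<in>UNIV. \<Sum>v\<in>UNIV. ?w u v * ((1 - ?s u v) / 2 * (indicator S u * indicator T v)))" for S T
    unfolding neg_edge_weight_def ind[where S = S]
  proof (intro sum.cong refl)
    fix u
    have "(\<Sum>v\<in>{v \<in> T. {u, v} \<in> edges \<Gamma> \<and> signature \<Gamma> {u, v} = -1}. ?w u v) =
      (\<Sum>v\<in>UNIV. ?w u v * ((1 - ?s u v) / 2 * indicator T v))"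
      by (intro sum.mono_neutral_cong_left)
        (auto simp: weight_nonedge[OF \<Gamma>] edge_sign_def indicator_def dest: signature_cases[OF \<Gamma>])
    thus "indicator S u * (\<Sum>v\<in>{v \<in> T. {u, v} \<in> edges \<Gamma> \<and> signature \<Gamma> {u, v} = -1}. ?w u v) =
      (\<Sum>v\<in>UNIV. ?w u v * ((1 - ?s u v) / 2 * (indicator S u * indicator T v)))"
      by (simp add: sum_distrib_left mult_ac)
  qed
  have "edge_weight \<Gamma> S T = (\<Sum>u\<in>UNIV. \<Sum>v\<in>UNIV. ?w u v * (indicator S u * indicator T v))" for S T
    unfolding edge_weight_def ind[where S = S] ind[where S = T]
    by (simp only: sum_distrib_left mult_ac)
  hence "edge_weight \<Gamma> (V1 \<union> V2) (- (V1 \<union> V2)) =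
     (\<Sum>u\<in>UNIV. \<Sum>v\<in>UNIV. ?w u v * (indicator (V1 \<union> V2) u * indicator (- (V1 \<union> V2)) v))" .
  also have "\<dots> = (\<Sum>u\<in>UNIV. \<Sum>v\<in>UNIV. ?w u v * ((a u + b u) * (1 - a v - b v)))"
    using disj by (intro sum.cong refl) (auto simp: a_def b_def indicator_def)
  finally have bd: "edge_weight \<Gamma> (V1 \<union> V2) (- (V1 \<union> V2)) =
    (\<Sum>u\<in>UNIV. \<Sum>v\<in>UNIV. ?w u v * ((a u + b u) * (1 - a v - b v)))" .
  let ?N = "2 * pos_edge_weight \<Gamma> V1 V2 + neg_edge_weight \<Gamma> V1 V1 + neg_edge_weight \<Gamma> V2 V2
        + edge_weight \<Gamma> (V1 \<union> V2) (- (V1 \<union> V2))"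
  define h where "h u v = (1 + ?s u v) * (a u * b v) + (1 - ?s u v) / 2 * (a u * a v) +
     (1 - ?s u v) / 2 * (b u * b v) + (a u + b u) * (1 - a v - b v)" for u v
  have N: "?N = (\<Sum>u\<in>UNIV. \<Sum>v\<in>UNIV. ?w u v * h u v)"
  proof -
    have "?w u v * h u v = 2 * (?w u v * ((1 + ?s u v) / 2 * (a u * b v))) +
      ?w u v * ((1 - ?s u v) / 2 * (a u * a v)) + ?w u v * ((1 - ?s u v) / 2 * (b u * b v)) +
      ?w u v * ((a u + b u) * (1 - a v - b v))" for u v
      unfolding h_def by (simp add: distrib_left)
    thus ?thesis
      unfolding pos neg bd a_def[symmetric] b_def[symmetric]
      by (simp only: sum.distrib sum_distrib_left)
  qed
  \<comment> \<open>The summand \<open>h\<close> is not symmetric: boundary edges count only from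
    inside, and the cross term only from \<open>V1\<close> to \<open>V2\<close>. Adding the swapped
    sum produces the symmetric absolute value, checked on the possible values of \<open>a\<close>
    and \<open>b\<close>.\<close>
  have "?N = (\<Sum>u\<in>UNIV. \<Sum>v\<in>UNIV. ?w u v * h v u)"
    unfolding N by (subst sum.swap) (simp add: weight_commute[OF \<Gamma>])
  with N have "2 * ?N = (\<Sum>u\<in>UNIV. \<Sum>v\<in>UNIV. ?w u v * (h u v + h v u))"
    by (simp add: distrib_left sum.distrib)
  also have "\<dots> = (\<Sum>u\<in>UNIV. \<Sum>v\<in>UNIV. ?w u v * \<bar>(a u - b u) - ?s u v * (a v - b v)\<bar>)"
  proof (intro sum.cong refl)
    fix u v
    have "(a x, b x) \<in> {(0, 0), (1, 0), (0, 1)}" for x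
      using disj by (auto simp: a_def b_def indicator_def)
    from this[of u] this[of v] have "h u v + h v u = \<bar>(a u - b u) - ?s u v * (a v - b v)\<bar>"
      using edge_sign_cases[OF \<Gamma>, of u v] by (auto simp: h_def edge_sign_commute[of \<Gamma> v u])
    thus "?w u v * (h u v + h v u) = ?w u v * \<bar>(a u - b u) - ?s u v * (a v - b v)\<bar>" by simp
  qed
  finally have "?N = variation \<Gamma> (\<lambda>u. a u - b u)" by (simp add: variation_def)
  thus ?thesis by (simp add: signed_bipartiteness_ratio_def vol_def a_def b_def)
qed

lemma signed_cheeger_finite:
  "finite {signed_bipartiteness_ratio \<Gamma> \<mu> V1 V2 | V1 V2. V1 \<inter> V2 = {} \<and> V1 \<union> V2 \<noteq> {}}"
  by (rule finite_subset[of _ "(\<lambda>(V1, V2). signed_bipartiteness_ratio \<Gamma> \<mu> V1 V2) ` UNIV"]) auto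

lemma signed_cheeger_nonneg:
  assumes "signed_graph \<Gamma>"
  shows "0 \<le> signed_cheeger \<Gamma> (\<lambda>_. 1)"
proof -
  let ?R = "{signed_bipartiteness_ratio \<Gamma> (\<lambda>_. 1) V1 V2 | V1 V2. V1 \<inter> V2 = {} \<and> V1 \<union> V2 \<noteq> {}}"
  have "?R \<noteq> {}" by (auto intro: exI[of _ UNIV] exI[of _ "{}"])
  hence "signed_cheeger \<Gamma> (\<lambda>_. 1) \<in> ?R"
    unfolding signed_cheeger_def by (rule Min_in[OF signed_cheeger_finite])
  thus ?thesis using variation_nonneg[OF assms] by (auto simp: bipartiteness_ratio_eq_variation[OF assms])
qed

lemma signed_cheeger_card_le:
  assumes \<Gamma>: "signed_graph \<Gamma>" and "V1 \<inter> V2 = {}"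
  shows "signed_cheeger \<Gamma> (\<lambda>_. 1) * real (card (V1 \<union> V2)) \<le>
    variation \<Gamma> (\<lambda>u. indicator V1 u - indicator V2 u)"
proof (cases "V1 \<union> V2 = {}")
  case False
  have "signed_cheeger \<Gamma> (\<lambda>_. 1) \<le> signed_bipartiteness_ratio \<Gamma> (\<lambda>_. 1) V1 V2"
    unfolding signed_cheeger_def using assms False by (intro Min_le[OF signed_cheeger_finite]) blast
  moreover have "card (V1 \<union> V2) > 0" using False by (simp add: card_gt_0_iff)
  ultimately show ?thesis
    by (simp add: bipartiteness_ratio_eq_variation[OF assms] pos_le_divide_eq)
qed (simp add: variation_nonneg[OF \<Gamma>])

text \<open>A discrete co-area formula by induction on the support: the multiple \<open>c\<close> of
  \<open>sgn g\<close> is peeled off, with \<open>c\<close> the least nonzero value of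
  \<open>\<bar>g\<bar>\<close>. Both sides are additive under this, and \<open>sgn g\<close> comes
  from an admissible pair of sets.\<close>

lemma signed_cheeger_le_variation:
  assumes \<Gamma>: "signed_graph \<Gamma>"
  shows "signed_cheeger \<Gamma> (\<lambda>_. 1) * (\<Sum>u\<in>UNIV. \<bar>g u\<bar>) \<le> variation \<Gamma> g"
proof (induction "card {u. g u \<noteq> 0}" arbitrary: g rule: less_induct)
  case less
  let ?h = "signed_cheeger \<Gamma> (\<lambda>_. 1)"
  show ?case
  proof (cases "{u. g u \<noteq> 0} = {}")
    case True
    thus ?thesis using variation_nonneg[OF \<Gamma>, of g] by simp
  next
    case False
    define c where "c = Min ((\<lambda>u. \<bar>g u\<bar>) ` {u. g u \<noteq> 0})"
    have "c \<in> (\<lambda>u. \<bar>g u\<bar>) ` {u. g u \<noteq> 0}" unfolding c_def using False by (intro Min_in) auto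
    then obtain u0 where u0: "g u0 \<noteq> 0" "c = \<bar>g u0\<bar>" by auto
    have c_le: "g u \<noteq> 0 \<Longrightarrow> c \<le> \<bar>g u\<bar>" for u unfolding c_def by (intro Min_le) auto
    define V1 V2 where "V1 = {u. g u > 0}" and "V2 = {u. g u < 0}"
    define x :: "'a \<Rightarrow> real" where "x u = indicator V1 u - indicator V2 u" for u
    define g' where "g' u = g u - c * x u" for u
    have c: "c > 0" using u0 by simp
    have x: "x u = sgn (g u)" for u by (simp add: x_def V1_def V2_def sgn_if indicator_def)
    have V: "V1 \<inter> V2 = {}" "V1 \<union> V2 = {u. g u \<noteq> 0}" by (auto simp: V1_def V2_def)
    have g'0: "g u = 0 \<Longrightarrow> g' u = 0" for u by (simp add: g'_def x)
    have "g' u0 = 0" using u0 by (simp add: g'_def x sgn_mult_abs abs_mult_sgn mult.commute)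
    hence "{u. g' u \<noteq> 0} \<subset> {u. g u \<noteq> 0}" using u0 g'0 by blast
    hence "card {u. g' u \<noteq> 0} < card {u. g u \<noteq> 0}" by (intro psubset_card_mono) auto
    from less.hyps[OF this] have IH: "?h * (\<Sum>u\<in>UNIV. \<bar>g' u\<bar>) \<le> variation \<Gamma> g'" .
    have "\<bar>g u\<bar> = \<bar>g' u\<bar> + c * \<bar>x u\<bar>" for u
      using c_le[of u] c by (auto simp: g'_def x sgn_if)
    hence "(\<Sum>u\<in>UNIV. \<bar>g u\<bar>) = (\<Sum>u\<in>UNIV. \<bar>g' u\<bar>) + c * (\<Sum>u\<in>UNIV. \<bar>x u\<bar>)"
      by (simp add: sum.distrib sum_distrib_left)
    also have "(\<Sum>u\<in>UNIV. \<bar>x u\<bar>) = (\<Sum>u\<in>{u. g u \<noteq> 0}. 1)"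
      by (intro sum.mono_neutral_cong_right) (auto simp: x sgn_if)
    also have "\<dots> = real (card (V1 \<union> V2))" unfolding V(2) by simp
    finally have sum: "(\<Sum>u\<in>UNIV. \<bar>g u\<bar>) = (\<Sum>u\<in>UNIV. \<bar>g' u\<bar>) + c * real (card (V1 \<union> V2))" .
    \<comment> \<open>Peeling moves nonzero values towards 0 by \<open>c\<close> without crossing
      it, so on each edge the two differences never have opposite signs and the absolute value
      splits exactly.\<close>
    have "weight \<Gamma> u v * \<bar>g u - edge_sign \<Gamma> u v * g v\<bar> = weight \<Gamma> u v * \<bar>g' u - edge_sign \<Gamma> u v * g' v\<bar>
       + c * (weight \<Gamma> u v * \<bar>x u - edge_sign \<Gamma> u v * x v\<bar>)" for u v
    proof -
      have "\<bar>g u - edge_sign \<Gamma> u v * g v\<bar> = \<bar>g' u - edge_sign \<Gamma> u v * g' v\<bar>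
        + c * \<bar>x u - edge_sign \<Gamma> u v * x v\<bar>"
        using edge_sign_cases[OF \<Gamma>, of u v] c_le[of u] c_le[of v] c
        by (auto simp: g'_def x sgn_if abs_if)
      thus ?thesis by (simp add: distrib_left mult.left_commute)
    qed
    hence "variation \<Gamma> g = variation \<Gamma> g' + c * variation \<Gamma> x"
      by (simp add: variation_def sum.distrib sum_distrib_left add_divide_distrib)
    moreover have "c * (?h * real (card (V1 \<union> V2))) \<le> c * variation \<Gamma> x"
      using signed_cheeger_card_le[OF \<Gamma> V(1)] c unfolding x_def by (intro mult_left_mono) auto
    ultimately show ?thesis using IH by (simp add: sum distrib_left mult_ac)
  qed
qed

section \<open>The improved Cheeger inequality\<close>

text \<open>Used with \<open>m = 1\<close> for the bumps at one point and with \<open>m = 2\<close>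
  for functions meeting the two ends of an edge.\<close>

lemma sum_square_le_card_nonzero:
  fixes y :: "'i \<Rightarrow> real"
  assumes "finite I" "card {i \<in> I. y i \<noteq> 0} \<le> m"
  shows "(\<Sum>i\<in>I. y i)\<^sup>2 \<le> real m * (\<Sum>i\<in>I. (y i)\<^sup>2)"
proof -
  let ?S = "{i \<in> I. y i \<noteq> 0}"
  have "(\<Sum>i\<in>I. y i) = (\<Sum>i\<in>?S. y i)" "(\<Sum>i\<in>I. (y i)\<^sup>2) = (\<Sum>i\<in>?S. (y i)\<^sup>2)"
    using assms(1) by (auto intro!: sum.mono_neutral_right)
  moreover have "(\<Sum>i\<in>?S. y i)\<^sup>2 \<le> (\<Sum>i\<in>?S. (y i)\<^sup>2) * real (card ?S)"
    by (rule sum_squared_le_sum_of_squares)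
  moreover have "\<dots> \<le> (\<Sum>i\<in>?S. (y i)\<^sup>2) * real m"
    using assms(2) by (intro mult_left_mono sum_nonneg) auto
  ultimately show ?thesis by (simp add: mult.commute)
qed

lemma weighted_Cauchy_Schwarz:
  fixes w a b :: "'i \<Rightarrow> real"
  assumes "\<And>i. i \<in> I \<Longrightarrow> 0 \<le> w i"
  shows "(\<Sum>i\<in>I. w i * (a i * b i)) \<le> sqrt (\<Sum>i\<in>I. w i * (a i)\<^sup>2) * sqrt (\<Sum>i\<in>I. w i * (b i)\<^sup>2)"
proof -
  have "(\<Sum>i\<in>I. (sqrt (w i) * a i) * (sqrt (w i) * b i))\<^sup>2 \<le>
      (\<Sum>i\<in>I. (sqrt (w i) * a i)\<^sup>2) * (\<Sum>i\<in>I. (sqrt (w i) * b i)\<^sup>2)"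
    by (rule Cauchy_Schwarz_ineq_sum)
  moreover have "(sqrt (w i) * a i) * (sqrt (w i) * b i) = w i * (a i * b i)"
    "(sqrt (w i) * a i)\<^sup>2 = w i * (a i)\<^sup>2" "(sqrt (w i) * b i)\<^sup>2 = w i * (b i)\<^sup>2" if "i \<in> I" for i
  proof -
    have "sqrt (w i) * sqrt (w i) = w i" using assms[OF that] by simp
    thus "(sqrt (w i) * a i) * (sqrt (w i) * b i) = w i * (a i * b i)" by (metis mult.assoc mult.left_commute)
  qed (simp_all add: power_mult_distrib assms[OF that])
  ultimately have "(\<Sum>i\<in>I. w i * (a i * b i))\<^sup>2 \<le> (\<Sum>i\<in>I. w i * (a i)\<^sup>2) * (\<Sum>i\<in>I. w i * (b i)\<^sup>2)"
    by simp
  hence "sqrt ((\<Sum>i\<in>I. w i * (a i * b i))\<^sup>2) \<le> sqrt ((\<Sum>i\<in>I. w i * (a i)\<^sup>2) * (\<Sum>i\<in>I. w i * (b i)\<^sup>2))"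
    by (rule real_sqrt_le_mono)
  thus ?thesis by (simp add: real_sqrt_mult)
qed

lemma square_sum_bump_le:
  assumes "mono t" "t 0 = 0"
  shows "(\<Sum>i<n. \<bar>bump (t i) (t (Suc i)) x\<bar>)\<^sup>2 \<le> (\<Sum>i<n. (bump (t i) (t (Suc i)) x)\<^sup>2)"
proof -
  have "card {i \<in> {..<n}. \<bar>bump (t i) (t (Suc i)) x\<bar> \<noteq> 0} \<le> 1"
    using bump_unique_index[OF assms] by (subst card_le_Suc0_iff_eq[unfolded One_nat_def[symmetric]]) auto
  from sum_square_le_card_nonzero[OF _ this] show ?thesis by simp
qed

text \<open>Cauchy-Schwarz over ordered pairs: one factor is twice the energy, and \<open>(D u + D
  v)\<^sup>2 \<le> 2 * (D u)\<^sup>2 + 2 * (D v)\<^sup>2\<close> bounds the other by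
  \<open>4 * max_degree \<Gamma> * K\<close>.\<close>

lemma sum_edge_pairs_le:
  assumes \<Gamma>: "signed_graph \<Gamma>" and D: "(\<Sum>u\<in>UNIV. (D u)\<^sup>2) \<le> K"
  shows "(\<Sum>u\<in>UNIV. \<Sum>v\<in>UNIV. weight \<Gamma> u v * (\<bar>f u - edge_sign \<Gamma> u v * f v\<bar> * (D u + D v)))
    \<le> 2 * (sqrt (energy \<Gamma> f) * sqrt (2 * max_degree \<Gamma> * K))"
proof -
  let ?w = "weight \<Gamma>" and ?d = "\<lambda>u v. \<bar>f u - edge_sign \<Gamma> u v * f v\<bar>"
  have "(\<Sum>u\<in>UNIV. \<Sum>v\<in>UNIV. ?w u v * (?d u v * (D u + D v))) \<le>
    sqrt (\<Sum>u\<in>UNIV. \<Sum>v\<in>UNIV. ?w u v * (?d u v)\<^sup>2) * sqrt (\<Sum>u\<in>UNIV. \<Sum>v\<in>UNIV. ?w u v * (D u + D v)\<^sup>2)"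
    using weighted_Cauchy_Schwarz[of "UNIV \<times> UNIV" "\<lambda>(u, v). ?w u v" "\<lambda>(u, v). ?d u v" "\<lambda>(u, v). D u + D v"]
      weight_nonneg[OF \<Gamma>] by (simp add: sum.cartesian_product split_def)
  also have "(\<Sum>u\<in>UNIV. \<Sum>v\<in>UNIV. ?w u v * (?d u v)\<^sup>2) = 2 * energy \<Gamma> f"
    by (simp add: energy_def)
  also have "sqrt (2 * energy \<Gamma> f) * sqrt (\<Sum>u\<in>UNIV. \<Sum>v\<in>UNIV. ?w u v * (D u + D v)\<^sup>2) \<le>
      sqrt (2 * energy \<Gamma> f) * sqrt (2 * (2 * max_degree \<Gamma> * K))"
  proof (intro mult_left_mono real_sqrt_le_mono)
    have "(\<Sum>u\<in>UNIV. \<Sum>v\<in>UNIV. ?w u v * (D u + D v)\<^sup>2) \<le>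
       (\<Sum>u\<in>UNIV. \<Sum>v\<in>UNIV. 2 * (?w u v * (D u)\<^sup>2) + 2 * (?w u v * (D v)\<^sup>2))"
    proof (intro sum_mono)
      fix u v
      have "0 \<le> (D u - D v)\<^sup>2" by simp
      hence "(D u + D v)\<^sup>2 \<le> 2 * (D u)\<^sup>2 + 2 * (D v)\<^sup>2" by (simp add: power2_eq_square algebra_simps)
      from mult_left_mono[OF this weight_nonneg[OF \<Gamma>]]
      show "?w u v * (D u + D v)\<^sup>2 \<le> 2 * (?w u v * (D u)\<^sup>2) + 2 * (?w u v * (D v)\<^sup>2)"
        by (simp add: algebra_simps)
    qed
    also have "\<dots> = 4 * (\<Sum>u\<in>UNIV. wdegree \<Gamma> u * (D u)\<^sup>2)"
      by (simp add: sum.distrib sum_weight_square_fst sum_weight_square_snd[OF \<Gamma>] flip: sum_distrib_left)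
    also have "(\<Sum>u\<in>UNIV. wdegree \<Gamma> u * (D u)\<^sup>2) \<le> (\<Sum>u\<in>UNIV. max_degree \<Gamma> * (D u)\<^sup>2)"
      by (intro sum_mono mult_right_mono wdegree_le_max_degree) auto
    also have "\<dots> \<le> max_degree \<Gamma> * K"
      unfolding sum_distrib_left[symmetric] by (intro mult_left_mono D max_degree_nonneg[OF \<Gamma>])
    finally show "(\<Sum>u\<in>UNIV. \<Sum>v\<in>UNIV. ?w u v * (D u + D v)\<^sup>2) \<le> 2 * (2 * max_degree \<Gamma> * K)" by simp
  qed (simp add: energy_nonneg[OF \<Gamma>])
  also have "\<dots> = 2 * (sqrt (energy \<Gamma> f) * sqrt (2 * max_degree \<Gamma> * K))"
    by (simp add: real_sqrt_mult)
  finally show ?thesis .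
qed

text \<open>The co-area inequality for \<open>g\<close>, the profile of \<open>f\<close>. The mass
  of \<open>g\<close> is bounded below by \<open>abs_profile_ge\<close>; its variation splits into
  an energy term and a term weighted by \<open>D\<close>, the distance of \<open>f\<close> to the
  thresholds.\<close>

lemma signed_cheeger_le_layered:
  assumes \<Gamma>: "signed_graph \<Gamma>" and t: "mono t" "t 0 = 0" and f: "\<And>u. \<bar>f u\<bar> \<le> t n"
    and mass: "\<And>i. i < n \<Longrightarrow> (\<Sum>u\<in>UNIV. (bump (t i) (t (Suc i)) (f u))\<^sup>2) \<le> C"
  shows "signed_cheeger \<Gamma> (\<lambda>_. 1) * (\<Sum>u\<in>UNIV. (f u)\<^sup>2) \<le>
    2 * real n * (energy \<Gamma> f + sqrt (energy \<Gamma> f) * sqrt (2 * max_degree \<Gamma> * (real n * C)))"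
proof -
  let ?h = "signed_cheeger \<Gamma> (\<lambda>_. 1)" and ?w = "weight \<Gamma>" and ?s = "edge_sign \<Gamma>"
  define g where "g u = profile t n (f u)" for u
  define D where "D u = (\<Sum>i<n. \<bar>bump (t i) (t (Suc i)) (f u)\<bar>)" for u
  let ?d = "\<lambda>u v. \<bar>f u - ?s u v * f v\<bar>"
  have "(\<Sum>u\<in>UNIV. (D u)\<^sup>2) \<le> (\<Sum>u\<in>UNIV. \<Sum>i<n. (bump (t i) (t (Suc i)) (f u))\<^sup>2)"
    unfolding D_def by (intro sum_mono square_sum_bump_le t)
  also have "\<dots> = (\<Sum>i<n. \<Sum>u\<in>UNIV. (bump (t i) (t (Suc i)) (f u))\<^sup>2)" by (rule sum.swap)
  also have "\<dots> \<le> (\<Sum>i<n. C)" using mass by (intro sum_mono) auto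
  finally have D: "(\<Sum>u\<in>UNIV. (D u)\<^sup>2) \<le> real n * C" by simp
  have "?w u v * \<bar>g u - ?s u v * g v\<bar> \<le>
     (?w u v * (?d u v * (D u + D v)) + ?w u v * (f u - ?s u v * f v)\<^sup>2) / 2" for u v
  proof -
    \<comment> \<open>Oddness moves the edge sign inside, so the one-variable estimate applies to
      \<open>f u\<close> and \<open>?s u v * f v\<close>.\<close>
    have eq: "?s u v * g v = profile t n (?s u v * f v)"
      "D v = (\<Sum>i<n. \<bar>bump (t i) (t (Suc i)) (?s u v * f v)\<bar>)"
      using edge_sign_cases[OF \<Gamma>, of u v] by (auto simp: g_def D_def profile_minus bump_minus)
    have "\<bar>g u - ?s u v * g v\<bar> \<le> ?d u v * (D u + D v + ?d u v) / 2"
      using profile_diff_le[OF t, of n "f u" "?s u v * f v"] by (simp only: eq g_def[of u] D_def[of u])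
    also have "\<dots> = (?d u v * (D u + D v) + (f u - ?s u v * f v)\<^sup>2) / 2"
      by (simp add: distrib_left power2_eq_square)
    finally show ?thesis
      using mult_left_mono[OF _ weight_nonneg[OF \<Gamma>, of u v]] by (fastforce simp: distrib_left)
  qed
  hence "2 * variation \<Gamma> g \<le>
    (\<Sum>u\<in>UNIV. \<Sum>v\<in>UNIV. (?w u v * (?d u v * (D u + D v)) + ?w u v * (f u - ?s u v * f v)\<^sup>2) / 2)"
    unfolding variation_def by (simp add: sum_mono)
  also have "\<dots> = (\<Sum>u\<in>UNIV. \<Sum>v\<in>UNIV. ?w u v * (?d u v * (D u + D v))) / 2 + energy \<Gamma> f"
    by (simp add: energy_def sum.distrib add_divide_distrib sum_divide_distrib)
  also have "\<dots> \<le> sqrt (energy \<Gamma> f) * sqrt (2 * max_degree \<Gamma> * (real n * C)) + energy \<Gamma> f"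
    using sum_edge_pairs_le[OF \<Gamma> D, of f] by simp
  finally have var: "2 * variation \<Gamma> g \<le> energy \<Gamma> f + sqrt (energy \<Gamma> f) * sqrt (2 * max_degree \<Gamma> * (real n * C))"
    by simp
  have "(\<Sum>u\<in>UNIV. (f u)\<^sup>2) \<le> (\<Sum>u\<in>UNIV. 4 * real n * \<bar>g u\<bar>)"
    unfolding g_def by (intro sum_mono abs_profile_ge t f)
  hence "?h * (\<Sum>u\<in>UNIV. (f u)\<^sup>2) \<le> ?h * (4 * real n * (\<Sum>u\<in>UNIV. \<bar>g u\<bar>))"
    using signed_cheeger_nonneg[OF \<Gamma>] by (intro mult_left_mono) (auto simp: sum_distrib_left)
  also have "\<dots> = 4 * real n * (?h * (\<Sum>u\<in>UNIV. \<bar>g u\<bar>))" by simp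
  also have "\<dots> \<le> 4 * real n * variation \<Gamma> g"
    by (intro mult_left_mono signed_cheeger_le_variation[OF \<Gamma>]) auto
  also have "\<dots> = 2 * real n * (2 * variation \<Gamma> g)" by simp
  also have "\<dots> \<le> 2 * real n * (energy \<Gamma> f + sqrt (energy \<Gamma> f) * sqrt (2 * max_degree \<Gamma> * (real n * C)))"
    by (intro mult_left_mono var) auto
  finally show ?thesis .
qed

section \<open>Upper bounds for the \<open>k\<close>-th eigenvalue\<close>

text \<open>Disjoint supports make the functions orthogonal, so their span has dimension at least
  \<open>k\<close> and serves as test space. An edge meets at most two supports, which costs the
  factor 2 in the energy of a combination.\<close>

lemma eigval_le_disjoint_supports:
  fixes \<Gamma> :: "('v::finite) sgraph" and F :: "'i \<Rightarrow> real^'v"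
  assumes \<Gamma>: "signed_graph \<Gamma>" and J: "finite J" "1 \<le> k" "k \<le> card J"
    and disj: "\<And>i j u. i \<in> J \<Longrightarrow> j \<in> J \<Longrightarrow> F i $ u \<noteq> 0 \<Longrightarrow> F j $ u \<noteq> 0 \<Longrightarrow> i = j"
    and nz: "\<And>i. i \<in> J \<Longrightarrow> F i \<noteq> 0"
    and le: "\<And>i. i \<in> J \<Longrightarrow> energy \<Gamma> (\<lambda>u. F i $ u) \<le> q * (F i \<bullet> F i)"
  shows "eigval k (signed_laplacian \<Gamma>) \<le> 2 * q"
proof -
  have orth: "F i \<bullet> F j = 0" if "i \<in> J" "j \<in> J" "i \<noteq> j" for i j
    using disj[OF that(1,2)] that(3) unfolding inner_vec_def by (intro sum.neutral) auto
  have inj: "inj_on F J"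
    using orth nz by (metis inj_onI inner_eq_zero_iff)
  have ind: "independent (F ` J)"
    using orth nz by (intro pairwise_orthogonal_independent) (auto simp: pairwise_def orthogonal_def)
  have dim: "dim (span (F ` J)) = card J"
    using ind inj by (simp add: dim_eq_card_independent card_image)
  have "dim (span (F ` J)) \<le> CARD('v)" using dim_subset_UNIV_cart by blast
  hence k: "k \<in> {1..CARD('v)}" using dim J by simp
  show ?thesis
  proof (rule eigval_le_on_subspace[OF transpose_signed_laplacian[OF \<Gamma>] k subspace_span])
    show "k \<le> dim (span (F ` J))" using dim J by simp
    fix x assume "x \<in> span (F ` J)"
    then obtain c' where "x = (\<Sum>v\<in>F ` J. c' v *\<^sub>R v)"
      using J(1) by (auto simp: span_finite)
    hence x: "x = (\<Sum>i\<in>J. c' (F i) *\<^sub>R F i)" by (simp add: sum.reindex[OF inj])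
    define c where "c i = c' (F i)" for i
    let ?s = "edge_sign \<Gamma>"
    have xu: "x $ u = (\<Sum>i\<in>J. c i * F i $ u)" for u by (simp add: x c_def)
    have "x \<bullet> x = (\<Sum>i\<in>J. \<Sum>j\<in>J. c i * (c j * (F j \<bullet> F i)))"
      unfolding x c_def by (simp add: inner_sum_left inner_sum_right sum_distrib_left)
    also have "\<dots> = (\<Sum>i\<in>J. \<Sum>j\<in>J. if j = i then (c i)\<^sup>2 * (F i \<bullet> F i) else 0)"
      using orth by (intro sum.cong refl) (auto simp: power2_eq_square)
    also have "\<dots> = (\<Sum>i\<in>J. (c i)\<^sup>2 * (F i \<bullet> F i))" using J(1) by simp
    finally have xx: "x \<bullet> x = (\<Sum>i\<in>J. (c i)\<^sup>2 * (F i \<bullet> F i))" .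
    have pt: "(x $ u - ?s u v * x $ v)\<^sup>2 \<le> 2 * (\<Sum>i\<in>J. (c i)\<^sup>2 * (F i $ u - ?s u v * F i $ v)\<^sup>2)" for u v
    proof -
      let ?y = "\<lambda>i. c i * (F i $ u - ?s u v * F i $ v)"
      have A: "card {i \<in> J. F i $ w \<noteq> 0} \<le> 1" for w
        using disj J(1) by (subst card_le_Suc0_iff_eq[unfolded One_nat_def[symmetric]]) auto
      have "card {i \<in> J. ?y i \<noteq> 0} \<le> card ({i \<in> J. F i $ u \<noteq> 0} \<union> {i \<in> J. F i $ v \<noteq> 0})"
        using J(1) by (intro card_mono) auto
      also have "\<dots> \<le> card {i \<in> J. F i $ u \<noteq> 0} + card {i \<in> J. F i $ v \<noteq> 0}" by (rule card_Un_le)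
      also have "\<dots> \<le> 2" using A[of u] A[of v] by linarith
      finally have "(\<Sum>i\<in>J. ?y i)\<^sup>2 \<le> real 2 * (\<Sum>i\<in>J. (?y i)\<^sup>2)"
        by (rule sum_square_le_card_nonzero[OF J(1)])
      moreover have "(\<Sum>i\<in>J. ?y i) = x $ u - ?s u v * x $ v"
        by (simp add: xu right_diff_distrib sum_subtractf sum_distrib_left mult_ac)
      ultimately show ?thesis by (simp add: power_mult_distrib)
    qed
    have "2 * energy \<Gamma> (\<lambda>u. x $ u) \<le> (\<Sum>u\<in>UNIV. \<Sum>v\<in>UNIV. weight \<Gamma> u v *
      (2 * (\<Sum>i\<in>J. (c i)\<^sup>2 * (F i $ u - ?s u v * F i $ v)\<^sup>2)))"
      unfolding energy_def by (simp del: mult.assoc add: sum_mono mult_left_mono[OF pt] weight_nonneg[OF \<Gamma>])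
    also have "\<dots> = (\<Sum>u\<in>UNIV. \<Sum>v\<in>UNIV. \<Sum>i\<in>J. 2 * (c i)\<^sup>2 * (weight \<Gamma> u v * (F i $ u - ?s u v * F i $ v)\<^sup>2))"
      by (simp add: sum_distrib_left mult_ac)
    also have "\<dots> = (\<Sum>u\<in>UNIV. \<Sum>i\<in>J. \<Sum>v\<in>UNIV. 2 * (c i)\<^sup>2 * (weight \<Gamma> u v * (F i $ u - ?s u v * F i $ v)\<^sup>2))"
      by (intro sum.cong refl sum.swap)
    also have "\<dots> = (\<Sum>i\<in>J. \<Sum>u\<in>UNIV. \<Sum>v\<in>UNIV. 2 * (c i)\<^sup>2 * (weight \<Gamma> u v * (F i $ u - ?s u v * F i $ v)\<^sup>2))"
      by (rule sum.swap)
    also have "\<dots> = (\<Sum>i\<in>J. 2 * (c i)\<^sup>2 * (2 * energy \<Gamma> (\<lambda>u. F i $ u)))"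
      by (simp only: two_energy sum_distrib_left)
    also have "\<dots> = 2 * (\<Sum>i\<in>J. 2 * (c i)\<^sup>2 * energy \<Gamma> (\<lambda>u. F i $ u))"
      by (simp add: sum_distrib_left mult_ac)
    also have "(\<Sum>i\<in>J. 2 * (c i)\<^sup>2 * energy \<Gamma> (\<lambda>u. F i $ u)) \<le> (\<Sum>i\<in>J. 2 * (c i)\<^sup>2 * (q * (F i \<bullet> F i)))"
      by (intro sum_mono mult_left_mono le) auto
    also have "\<dots> = 2 * q * (x \<bullet> x)" unfolding xx by (simp add: sum_distrib_left mult_ac)
    finally show "x \<bullet> (signed_laplacian \<Gamma> *v x) \<le> 2 * q * (x \<bullet> x)"
      by (simp add: signed_laplacian_quadratic_form[OF \<Gamma>])
  qed
qed

lemma eigval_less_equal_mass: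
  fixes \<Gamma> :: "('v::finite) sgraph"
  assumes \<Gamma>: "signed_graph \<Gamma>" and t: "mono t" "t 0 = 0" and k: "1 \<le> k"
    and C: "0 < C" and pos: "0 < energy \<Gamma> f"
    and mass: "\<And>i. i < 2 * k \<Longrightarrow> (\<Sum>u\<in>UNIV. (bump (t i) (t (Suc i)) (f u))\<^sup>2) = C"
  shows "eigval k (signed_laplacian \<Gamma>) < 2 * energy \<Gamma> f / (real k * C)"
proof -
  define F :: "nat \<Rightarrow> real^'v" where "F i = (\<chi> u. bump (t i) (t (Suc i)) (f u))" for i
  let ?E = "\<lambda>i. energy \<Gamma> (\<lambda>u. F i $ u)" and ?s = "edge_sign \<Gamma>"
  have norm: "F i \<bullet> F i = C" if "i < 2 * k" for i
    using mass[OF that] by (simp add: F_def inner_vec_def power2_eq_square)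
  have "(\<Sum>i<2 * k. (F i $ u - ?s u v * F i $ v)\<^sup>2) \<le> (f u - ?s u v * f v)\<^sup>2" for u v
  proof -
    have "?s u v * F i $ v = bump (t i) (t (Suc i)) (?s u v * f v)" for i
      using edge_sign_cases[OF \<Gamma>, of u v] by (auto simp: F_def bump_minus)
    thus ?thesis using sum_bump_diff_square_le[OF t, where n = "2 * k" and x = "f u" and y = "?s u v * f v"] by (simp add: F_def)
  qed
  hence "(\<Sum>u\<in>UNIV. \<Sum>v\<in>UNIV. weight \<Gamma> u v * (\<Sum>i<2 * k. (F i $ u - ?s u v * F i $ v)\<^sup>2)) \<le> 2 * energy \<Gamma> f"
    unfolding energy_def by (simp add: sum_mono mult_left_mono weight_nonneg[OF \<Gamma>])
  moreover have "(\<Sum>u\<in>UNIV. \<Sum>v\<in>UNIV. weight \<Gamma> u v * (\<Sum>i<2 * k. (F i $ u - ?s u v * F i $ v)\<^sup>2))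
    = 2 * (\<Sum>i<2 * k. ?E i)"
  proof -
    have "(\<Sum>u\<in>UNIV. \<Sum>v\<in>UNIV. weight \<Gamma> u v * (\<Sum>i<2 * k. (F i $ u - ?s u v * F i $ v)\<^sup>2)) =
      (\<Sum>u\<in>UNIV. \<Sum>i<2 * k. \<Sum>v\<in>UNIV. weight \<Gamma> u v * (F i $ u - ?s u v * F i $ v)\<^sup>2)"
      unfolding sum_distrib_left by (intro sum.cong refl sum.swap)
    also have "\<dots> = (\<Sum>i<2 * k. \<Sum>u\<in>UNIV. \<Sum>v\<in>UNIV. weight \<Gamma> u v * (F i $ u - ?s u v * F i $ v)\<^sup>2)"
      by (rule sum.swap)
    finally show ?thesis by (simp only: two_energy[symmetric] sum_distrib_left)
  qed
  ultimately have total: "(\<Sum>i<2 * k. ?E i) \<le> energy \<Gamma> f" by simp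
  define J where "J = {i \<in> {..<2 * k}. ?E i < energy \<Gamma> f / real k}"
  have fin: "finite J" and sub: "J \<subseteq> {..<2 * k}" by (auto simp: J_def)
  \<comment> \<open>Otherwise at least \<open>k + 1\<close> of the \<open>2 * k\<close> bumps would
    have energy at least \<open>energy \<Gamma> f / real k\<close>, exceeding the total.\<close>
  have cJ: "k \<le> card J"
  proof (rule ccontr)
    assume "\<not> k \<le> card J"
    hence "card ({..<2 * k} - J) \<ge> k + 1" using card_Diff_subset[OF fin sub] by simp
    hence "real (k + 1) * (energy \<Gamma> f / real k) \<le> real (card ({..<2 * k} - J)) * (energy \<Gamma> f / real k)"
      using pos by (intro mult_right_mono) auto
    also have "\<dots> = (\<Sum>i\<in>{..<2 * k} - J. energy \<Gamma> f / real k)" by simp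
    also have "\<dots> \<le> (\<Sum>i\<in>{..<2 * k} - J. ?E i)" by (intro sum_mono) (auto simp: J_def)
    also have "\<dots> \<le> (\<Sum>i<2 * k. ?E i)" by (intro sum_mono2) (auto simp: energy_nonneg[OF \<Gamma>])
    also have "\<dots> \<le> energy \<Gamma> f" by (rule total)
    finally show False using pos k by (simp add: field_simps)
  qed
  have ne: "J \<noteq> {}" using cJ k by auto
  \<comment> \<open>The maximum over the finite set \<open>J\<close> gives one bound for all chosen
    functions that is still strict.\<close>
  define q where "q = Max (?E ` J)"
  have "q \<in> ?E ` J" unfolding q_def using fin ne by (intro Max_in) auto
  hence q: "q < energy \<Gamma> f / real k" by (auto simp: J_def)
  have "eigval k (signed_laplacian \<Gamma>) \<le> 2 * (q / C)"
  proof (rule eigval_le_disjoint_supports[OF \<Gamma> fin k cJ, of F])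
    fix i j u assume "F i $ u \<noteq> 0" "F j $ u \<noteq> 0"
    thus "i = j" using bump_unique_index[OF t] by (simp add: F_def)
  next
    fix i assume i: "i \<in> J"
    have n: "F i \<bullet> F i = C" using norm i sub by auto
    thus "F i \<noteq> 0" using C by auto
    have "?E i \<le> q" unfolding q_def using i fin by (intro Max_ge) auto
    thus "?E i \<le> q / C * (F i \<bullet> F i)" using n C by simp
  qed
  also have "q / C < energy \<Gamma> f / real k / C" using q C by (rule divide_strict_right_mono)
  finally show ?thesis by (simp add: mult.commute)
qed

theorem theorem6p7:
  fixes \<Gamma> :: "('v::finite) sgraph" and k :: nat
  assumes "signed_graph \<Gamma>"
    and "k \<in> {1..CARD('v)}"
  shows "signed_cheeger \<Gamma> (\<lambda>_. 1) \<le> 8 * real k * eigval 1 (signed_laplacian \<Gamma>) \<or>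
         signed_cheeger \<Gamma> (\<lambda>_. 1)
           < 16 * sqrt (2 * max_degree \<Gamma>) * real k *
             (eigval 1 (signed_laplacian \<Gamma>) / sqrt (eigval k (signed_laplacian \<Gamma>)))"
proof -
  note \<Gamma> = assms(1)
  let ?h = "signed_cheeger \<Gamma> (\<lambda>_. 1)" and ?L = "signed_laplacian \<Gamma>"
  define l1 lk where "l1 = eigval 1 ?L" and "lk = eigval k ?L"
  have k: "1 \<le> k" "k \<le> CARD('v)" using assms(2) by auto
  have sym: "transpose ?L = ?L" by (rule transpose_signed_laplacian[OF \<Gamma>])
  obtain x where x: "norm x = 1" "?L *v x = l1 *\<^sub>R x"
    unfolding l1_def by (rule eigval_is_eigenvalue[OF sym, of 1]) (use k in auto)
  define f where "f u = x $ u" for u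
  have "x \<bullet> x = 1" using x(1) by (simp add: norm_eq_1)
  hence f1: "(\<Sum>u\<in>UNIV. (f u)\<^sup>2) = 1" by (simp add: f_def inner_vec_def power2_eq_square)
  have E: "energy \<Gamma> f = l1"
    using signed_laplacian_quadratic_form[OF \<Gamma>, of x] x \<open>x \<bullet> x = 1\<close> by (simp add: f_def[abs_def])
  have l1: "0 \<le> l1" using energy_nonneg[OF \<Gamma>, of f] by (simp add: E)
  have "l1 \<le> lk" unfolding l1_def lk_def using k by (intro eigval_mono[OF sym]) auto
  \<comment> \<open>With this mass the strict bound of \<open>eigval_less_equal_mass\<close> would
    read \<open>lk < lk\<close>.\<close>
  define C where "C = 2 * l1 / (real k * lk)"
  have C: "0 \<le> C" using l1 \<open>l1 \<le> lk\<close> by (simp add: C_def)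
  define M where "M = Max (range (\<lambda>u. \<bar>f u\<bar>))"
  have fM: "\<bar>f u\<bar> \<le> M" for u unfolding M_def by (intro Max_ge) auto
  have M: "0 \<le> M" using fM[of undefined] by linarith
  obtain t where t: "mono t" "t 0 = 0"
    and mass: "\<And>i. (\<Sum>u\<in>UNIV. (bump (t i) (t (Suc i)) (f u))\<^sup>2) \<le> C"
    and alt: "t (2 * k) = M \<or> (\<forall>i<2 * k. (\<Sum>u\<in>UNIV. (bump (t i) (t (Suc i)) (f u))\<^sup>2) = C)"
    by (rule exists_equal_mass_thresholds[OF C M, of f "2 * k"], rule that)
  show ?thesis
  proof (cases "l1 = 0")
    case True
    define r where "r i = (if i = 0 then 0 else M)" for i :: nat
    have "mono r" "r 0 = 0" using M by (auto simp: r_def mono_def)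
    hence "?h * (\<Sum>u\<in>UNIV. (f u)\<^sup>2) \<le> 2 * real 1 * (energy \<Gamma> f + sqrt (energy \<Gamma> f) *
        sqrt (2 * max_degree \<Gamma> * (real 1 * (\<Sum>u\<in>UNIV. (bump (r 0) (r (Suc 0)) (f u))\<^sup>2))))"
      using fM by (intro signed_cheeger_le_layered[OF \<Gamma>, of r f 1]) (auto simp: r_def)
    thus ?thesis using True f1 by (simp add: E l1_def)
  next
    case False
    hence pos: "0 < l1" "0 < lk" using l1 \<open>l1 \<le> lk\<close> by auto
    have Cpos: "0 < C" using pos k by (simp add: C_def)
    have "t (2 * k) = M"
    proof (rule ccontr)
      assume "t (2 * k) \<noteq> M"
      with alt have "lk < 2 * energy \<Gamma> f / (real k * C)"
        unfolding lk_def using pos E by (intro eigval_less_equal_mass[OF \<Gamma> t k(1) Cpos]) auto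
      also have "\<dots> = lk" using pos k by (simp add: E C_def)
      finally show False by simp
    qed
    hence "?h \<le> 2 * real (2 * k) * (l1 + sqrt l1 * sqrt (2 * max_degree \<Gamma> * (real (2 * k) * C)))"
      using signed_cheeger_le_layered[OF \<Gamma> t, of f "2 * k" C] fM mass by (simp add: f1 E)
    also have "real (2 * k) * C = 4 * (l1 / lk)" using k by (simp add: C_def)
    also have "sqrt l1 * sqrt (2 * max_degree \<Gamma> * (4 * (l1 / lk))) = 2 * (sqrt (2 * max_degree \<Gamma>) * (l1 / sqrt lk))"
    proof -
      have "sqrt l1 * sqrt (2 * max_degree \<Gamma> * (4 * (l1 / lk))) =
        2 * (sqrt (2 * max_degree \<Gamma>) * ((sqrt l1 * sqrt l1) / sqrt lk))"
        unfolding real_sqrt_mult real_sqrt_divide by simp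
      thus ?thesis using l1 by simp
    qed
    finally have "?h \<le> 4 * real k * l1 + 8 * sqrt (2 * max_degree \<Gamma>) * real k * (l1 / sqrt lk)"
      by (simp add: algebra_simps)
    \<comment> \<open>If the first alternative fails, the first summand is less than half of
      \<open>?h\<close>, so the second is more than half; this gives the strict inequality with 16
      in place of 8.\<close>
    thus ?thesis unfolding l1_def[symmetric] lk_def[symmetric] by linarith
  qed
qed

end
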